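(* For every $B\in 2^\omega$, the following are equivalent: (1) $B$ is uniformly almost everywhere dominating; (2) $B$ is almost everywhere dominating; (3) $B$ is positive measure dominating; (4) $\emptyset'\leq_{LR}B$.
   Context: Subsets of $\omega$ are identified with elements of $2^\omega$; $\mu$ is Lebesgue (fair-coin) measure on $2^\omega$, and "almost all" refers to $\mu$. A function $f:\omega\to\omega$ dominates $g:\omega\to\omega$ if $\exists m\,\forall n>m\ (f(n)\geq g(n))$. $B$ is almost everywhere dominating if for almost all $X\in 2^\omega$ and all functions $g\leq_T X$ there is a function $f\leq_T B$ such that $f$ dominates $g$. $B$ is uniformly almost everywhere dominating if there is a single function $f\leq_T B$ such that for almost all $X\in 2^\omega$ and all functions $g\leq_T X$, $f$ dominates $g$. $B$ is positive measure dominating if for every $\Pi^0_2$ class $P\subseteq 2^\omega$ with $\mu(P)>0$ there is a $\Pi^B_1$ class $Q\subseteq P$ with $\mu(Q)>0$. For an oracle $A$, a Martin-Löf test relative to $A$ is an $A$-computable (i.e. uniformly $\Sigma^A_1$) nested sequence of $\Sigma^A_1$ classes $U^A_0\supseteq U^A_1\supseteq\cdots$ in $2^\omega$ with $\mu(U^A_n)\leq 2^{-n}$. A set $R$ is $A$-random if $R\notin\bigcap_n U^A_n$ for every such test. $A\leq_{LR}B$ means: every $B$-random set is $A$-random. $\emptyset'$ is the halting set. *)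

theory Defs
  imports "HOL-Probability.Probability" "HOL-Library.Nat_Bijection"
begin

text \<open>
  Elements of Cantor space, and likewise subsets of \<open>\<omega>\<close>, are functions of type
  \<^typ>\<open>nat \<Rightarrow> bool\<close>.
\<close>

type_synonym cantor = "nat \<Rightarrow> bool"

text \<open>
  Partial recursive functions relative to an oracle.  All functions are unary; several
  arguments are passed as one number via the pairing function \<^const>\<open>prod_encode\<close>.
  The identity function is \<open>Pairing FstP SndP\<close>.
\<close>

datatype oprog =
    ZeroP
  | SuccP
  | FstP
  | SndP
  | OracleP
  | Pairing oprog oprog
  | Compose oprog oprog
  | PrimRec oprog oprog
  | Minim oprog

text \<open>\<open>eval A p n r\<close>: program \<open>p\<close> with oracle \<open>A\<close> halts on input \<open>n\<close> with output \<open>r\<close>.\<close>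

inductive eval :: "cantor \<Rightarrow> oprog \<Rightarrow> nat \<Rightarrow> nat \<Rightarrow> bool" for A :: cantor where
  eval_zero: "eval A ZeroP n 0"
| eval_succ: "eval A SuccP n (Suc n)"
| eval_fst: "eval A FstP n (fst (prod_decode n))"
| eval_snd: "eval A SndP n (snd (prod_decode n))"
| eval_oracle: "eval A OracleP n (of_bool (A n))"
| eval_pairing: "eval A p n a \<Longrightarrow> eval A q n b \<Longrightarrow> eval A (Pairing p q) n (prod_encode (a, b))"
| eval_compose: "eval A q n a \<Longrightarrow> eval A p a r \<Longrightarrow> eval A (Compose p q) n r"
| eval_primrec_0: "eval A p a r \<Longrightarrow> eval A (PrimRec p q) (prod_encode (a, 0)) r"
| eval_primrec_Suc:
    "eval A (PrimRec p q) (prod_encode (a, k)) s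
      \<Longrightarrow> eval A q (prod_encode (a, prod_encode (k, s))) r
      \<Longrightarrow> eval A (PrimRec p q) (prod_encode (a, Suc k)) r"
| eval_minim:
    "(\<And>z. z < y \<Longrightarrow> \<exists>v. eval A p (prod_encode (a, z)) (Suc v))
      \<Longrightarrow> eval A p (prod_encode (a, y)) 0
      \<Longrightarrow> eval A (Minim p) a y"

text \<open>An effective numbering of programs (a bijection with \<^typ>\<open>nat\<close>).\<close>

primrec index :: "oprog \<Rightarrow> nat" where
  "index ZeroP = 0"
| "index SuccP = 1"
| "index FstP = 2"
| "index SndP = 3"
| "index OracleP = 4"
| "index (Pairing p q) = 5 + 4 * prod_encode (index p, index q)"
| "index (Compose p q) = 6 + 4 * prod_encode (index p, index q)"
| "index (PrimRec p q) = 7 + 4 * prod_encode (index p, index q)"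
| "index (Minim p) = 8 + 4 * index p"

definition empty_oracle :: cantor where
  "empty_oracle = (\<lambda>_. False)"

definition halting_set :: cantor where
  "halting_set e \<longleftrightarrow> (\<exists>p r. index p = e \<and> eval empty_oracle p e r)"

definition computable_in :: "(nat \<Rightarrow> nat) \<Rightarrow> cantor \<Rightarrow> bool"  (infix "\<le>\<^sub>T" 50) where
  "f \<le>\<^sub>T A \<longleftrightarrow> (\<exists>p. \<forall>n. eval A p n (f n))"

definition ce_in :: "cantor \<Rightarrow> nat set \<Rightarrow> bool" where
  "ce_in A W \<longleftrightarrow> (\<exists>p. W = {n. \<exists>r. eval A p n r})"

definition prefix_code :: "cantor \<Rightarrow> nat \<Rightarrow> nat" where
  "prefix_code X k = list_encode (map (\<lambda>i. of_bool (X i)) [0..<k])"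

text \<open>
  A \<open>\<Sigma>\<^sup>A\<^sub>1\<close> class is the open set generated by a set of binary strings that is c.e. in \<open>A\<close>;
  in the uniform version one set c.e. in \<open>A\<close> of pairs (index, string) generates all classes.
\<close>

definition Sigma1_class :: "cantor \<Rightarrow> cantor set \<Rightarrow> bool" where
  "Sigma1_class A U \<longleftrightarrow> (\<exists>W. ce_in A W \<and> U = {X. \<exists>k. prefix_code X k \<in> W})"

definition uniformly_Sigma1 :: "cantor \<Rightarrow> (nat \<Rightarrow> cantor set) \<Rightarrow> bool" where
  "uniformly_Sigma1 A U \<longleftrightarrow>
    (\<exists>W. ce_in A W \<and> (\<forall>m. U m = {X. \<exists>k. prod_encode (m, prefix_code X k) \<in> W}))"

definition Pi1_class :: "cantor \<Rightarrow> cantor set \<Rightarrow> bool" where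
  "Pi1_class A Q \<longleftrightarrow> Sigma1_class A (- Q)"

definition Pi2_class :: "cantor \<Rightarrow> cantor set \<Rightarrow> bool" where
  "Pi2_class A P \<longleftrightarrow> (\<exists>U. uniformly_Sigma1 A U \<and> P = (\<Inter>m. U m))"

definition coin_measure :: "cantor measure" where
  "coin_measure = PiM UNIV (\<lambda>_. measure_pmf (bernoulli_pmf (1/2)))"

definition dominates :: "(nat \<Rightarrow> nat) \<Rightarrow> (nat \<Rightarrow> nat) \<Rightarrow> bool" where
  "dominates f g \<longleftrightarrow> (\<exists>m. \<forall>n>m. f n \<ge> g n)"

definition ae_dominating :: "cantor \<Rightarrow> bool" where
  "ae_dominating B \<longleftrightarrow>
    (AE X in coin_measure. \<forall>g. g \<le>\<^sub>T X \<longrightarrow> (\<exists>f. f \<le>\<^sub>T B \<and> dominates f g))"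

definition uniformly_ae_dominating :: "cantor \<Rightarrow> bool" where
  "uniformly_ae_dominating B \<longleftrightarrow>
    (\<exists>f. f \<le>\<^sub>T B \<and> (AE X in coin_measure. \<forall>g. g \<le>\<^sub>T X \<longrightarrow> dominates f g))"

definition positive_measure_dominating :: "cantor \<Rightarrow> bool" where
  "positive_measure_dominating B \<longleftrightarrow>
    (\<forall>P. Pi2_class empty_oracle P \<and> measure coin_measure P > 0 \<longrightarrow>
      (\<exists>Q. Pi1_class B Q \<and> Q \<subseteq> P \<and> measure coin_measure Q > 0))"

definition martin_loef_test :: "cantor \<Rightarrow> (nat \<Rightarrow> cantor set) \<Rightarrow> bool" where
  "martin_loef_test A U \<longleftrightarrow>
    uniformly_Sigma1 A U \<and> decseq U \<and> (\<forall>n. measure coin_measure (U n) \<le> (1/2) ^ n)"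

definition random_in :: "cantor \<Rightarrow> cantor \<Rightarrow> bool" where
  "random_in A R \<longleftrightarrow> (\<forall>U. martin_loef_test A U \<longrightarrow> R \<notin> (\<Inter>n. U n))"

definition LR_reducible :: "cantor \<Rightarrow> cantor \<Rightarrow> bool"  (infix "\<le>\<^sub>L\<^sub>R" 50) where
  "A \<le>\<^sub>L\<^sub>R B \<longleftrightarrow> (\<forall>R. random_in B R \<longrightarrow> random_in A R)"

end

theory Submission
  imports Defs
begin

text \<open>
  All four properties are equivalent to a fifth one, \<open>covers_sigma2 B\<close>: every \<open>\<Sigma>\<^sub>2\<close> set \<open>I\<close> of
  natural numbers of finite weight, where \<open>i\<close> weighs \<open>2\<^sup>-\<^sup>w\<close> with \<open>w\<close> its first component, is
  contained in a set of finite weight that is c.e. in \<open>B\<close>.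

  For positive measure domination, attach to the numbers \<open>i\<close> independent clopen sets \<open>clo i\<close> whose
  measure is half the weight of \<open>i\<close>.  Avoiding \<open>clo i\<close> for all sufficiently large
  \<open>i \<in> I\<close> defines a \<open>\<Pi>\<^sub>2\<close> class of positive measure; the \<open>i\<close> for which \<open>clo i\<close> nearly misses a
  \<open>\<Pi>\<^sub>1\<close> class of positive measure relative to \<open>B\<close> are c.e. in \<open>B\<close>, and by independence they have
  finite weight.  The covering property turns a Martin-Loef test relative to the halting set
  into a Solovay test relative to \<open>B\<close>, which gives LR-reducibility.  Conversely, if \<open>I\<close> has no
  such cover, forcing with \<open>\<Pi>\<^sub>1\<close> classes of positive measure relative to \<open>B\<close> yields a \<open>B\<close>-random set
  that lies in \<open>clo i\<close> for infinitely many \<open>i \<in> I\<close> and hence is not random relative to the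
  halting set.

  To obtain a uniformly dominating function, let \<open>modulus e n\<close> be a stage by which all but measure
  \<open>2\<^sup>-\<^sup>n\<close> of the oracles for which the \<open>e\<close>-th functional converges below \<open>n\<close> have converged.
  It is a limit of computable guesses.  A cover of the set of correct guesses, weighted
  by the measure of the oracles lost between \<open>n\<close> and \<open>n + 1\<close>, lets \<open>B\<close> act on its
  guesses: wrong ones are eventually withdrawn, and by Borel-Cantelli they affect almost every
  oracle only finitely often.
\<close>

section \<open>A calculus of computable functions\<close>

definition pfst :: "nat \<Rightarrow> nat" where "pfst n = fst (prod_decode n)"
definition psnd :: "nat \<Rightarrow> nat" where "psnd n = snd (prod_decode n)"

lemma pfst_pair [simp]: "pfst (prod_encode (a, b)) = a"
  and psnd_pair [simp]: "psnd (prod_encode (a, b)) = b"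
  and pair_pfst_psnd [simp]: "prod_encode (pfst n, psnd n) = n"
  by (simp_all add: pfst_def psnd_def)

definition decidable_in :: "cantor \<Rightarrow> (nat \<Rightarrow> bool) \<Rightarrow> bool" where
  "decidable_in A P \<longleftrightarrow> (\<lambda>x. of_bool (P x)) \<le>\<^sub>T A"

abbreviation decidable2_in :: "cantor \<Rightarrow> (nat \<Rightarrow> nat \<Rightarrow> bool) \<Rightarrow> bool" where
  "decidable2_in A P \<equiv> decidable_in A (\<lambda>u. P (pfst u) (psnd u))"

abbreviation decidable3_in :: "cantor \<Rightarrow> (nat \<Rightarrow> nat \<Rightarrow> nat \<Rightarrow> bool) \<Rightarrow> bool" where
  "decidable3_in A P \<equiv> decidable_in A (\<lambda>u. P (pfst u) (pfst (psnd u)) (psnd (psnd u)))"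

named_theorems comp

text \<open>
  The rules collected in \<open>comp\<close> are directed by the syntax of the function.  A variable bound by a
  quantifier, sum or recursion becomes the last component of a paired argument, so that after
  \<open>intro comp\<close> only the functions that are not built from library operations remain.
\<close>

lemma computable_compose: "f \<le>\<^sub>T A \<Longrightarrow> g \<le>\<^sub>T A \<Longrightarrow> (\<lambda>x. f (g x)) \<le>\<^sub>T A"
  unfolding computable_in_def by (meson eval_compose)

lemma decidable_compose: "decidable_in A P \<Longrightarrow> g \<le>\<^sub>T A \<Longrightarrow> decidable_in A (\<lambda>x. P (g x))"
  unfolding decidable_in_def by (rule computable_compose[of "\<lambda>x. of_bool (P x)"])

lemma computable_pair [comp]:
  "f \<le>\<^sub>T A \<Longrightarrow> g \<le>\<^sub>T A \<Longrightarrow> (\<lambda>x. prod_encode (f x, g x)) \<le>\<^sub>T A"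
  unfolding computable_in_def by (meson eval_pairing)

lemma computable_pfst_plain: "pfst \<le>\<^sub>T A" and computable_psnd_plain: "psnd \<le>\<^sub>T A"
  and computable_Suc_plain: "Suc \<le>\<^sub>T A" and computable_zero: "(\<lambda>_. 0) \<le>\<^sub>T A"
  and computable_oracle_plain: "(\<lambda>n. of_bool (A n)) \<le>\<^sub>T A"
  unfolding computable_in_def pfst_def psnd_def by (meson eval.intros)+

lemmas computable_pfst [comp] = computable_compose[OF computable_pfst_plain]
lemmas computable_psnd [comp] = computable_compose[OF computable_psnd_plain]
lemmas computable_Suc [comp] = computable_compose[OF computable_Suc_plain]
lemmas computable_oracle = computable_compose[OF computable_oracle_plain]

lemma decidable_oracle [comp]: "f \<le>\<^sub>T A \<Longrightarrow> decidable_in A (\<lambda>x. A (f x))"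
  unfolding decidable_in_def by (rule computable_oracle)

lemma computable_id [comp]: "(\<lambda>x. x) \<le>\<^sub>T A"
  using computable_pair[OF computable_pfst_plain computable_psnd_plain, of A] by simp

lemma computable_const [comp]: "(\<lambda>_. c) \<le>\<^sub>T A"
  by (induction c) (auto intro: computable_zero computable_Suc)

lemma computable2: "(\<lambda>u. h (pfst u) (psnd u)) \<le>\<^sub>T A \<Longrightarrow> f \<le>\<^sub>T A \<Longrightarrow> g \<le>\<^sub>T A \<Longrightarrow>
    (\<lambda>x. h (f x) (g x)) \<le>\<^sub>T A"
  using computable_compose[OF _ computable_pair, of "\<lambda>u. h (pfst u) (psnd u)" A f g] by simp

lemma computable3: "(\<lambda>u. h (pfst u) (pfst (psnd u)) (psnd (psnd u))) \<le>\<^sub>T A \<Longrightarrow>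
    f \<le>\<^sub>T A \<Longrightarrow> g \<le>\<^sub>T A \<Longrightarrow> k \<le>\<^sub>T A \<Longrightarrow> (\<lambda>x. h (f x) (g x) (k x)) \<le>\<^sub>T A"
  using computable_compose[OF _ computable_pair[OF _ computable_pair],
      of "\<lambda>u. h (pfst u) (pfst (psnd u)) (psnd (psnd u))" A f g k] by simp

lemma decidable2: "decidable2_in A P \<Longrightarrow> f \<le>\<^sub>T A \<Longrightarrow> g \<le>\<^sub>T A \<Longrightarrow>
    decidable_in A (\<lambda>x. P (f x) (g x))"
  unfolding decidable_in_def by (rule computable2)

lemma decidable3: "decidable3_in A P \<Longrightarrow> f \<le>\<^sub>T A \<Longrightarrow> g \<le>\<^sub>T A \<Longrightarrow> k \<le>\<^sub>T A \<Longrightarrow>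
    decidable_in A (\<lambda>x. P (f x) (g x) (k x))"
  unfolding decidable_in_def by (rule computable3)

text \<open>\<open>PrimRec\<close> hands its step program the parameter, the counter and the
  previous value nested as \<open>(a, (k, s))\<close>, which is the shape required of
  \<open>h\<close>. Arithmetic and coding operations are computable because they can be rewritten as
  instances of \<open>rec_nat\<close>.\<close>

lemma computable_rec_nat [comp]:
  assumes "b \<le>\<^sub>T A" "(\<lambda>u. h (pfst u) (pfst (psnd u)) (psnd (psnd u))) \<le>\<^sub>T A" "n \<le>\<^sub>T A"
  shows "(\<lambda>x. rec_nat (b x) (\<lambda>k s. h x k s) (n x)) \<le>\<^sub>T A"
proof -
  obtain p q where p: "\<And>x. eval A p x (b x)"
    and q: "\<And>u. eval A q u (h (pfst u) (pfst (psnd u)) (psnd (psnd u)))"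
    using assms(1,2) unfolding computable_in_def by auto
  have "eval A (PrimRec p q) (prod_encode (a, k)) (rec_nat (b a) (\<lambda>k s. h a k s) k)" for a k
  proof (induction k)
    case (Suc k)
    show ?case
      using eval_primrec_Suc[OF Suc q] by simp
  qed (simp add: p eval_primrec_0)
  then have "(\<lambda>u. rec_nat (b (pfst u)) (\<lambda>k s. h (pfst u) k s) (psnd u)) \<le>\<^sub>T A"
    unfolding computable_in_def by (intro exI[of _ "PrimRec p q"] allI) (metis pair_pfst_psnd)
  from computable2[OF this computable_id assms(3)] show ?thesis .
qed


section \<open>Arithmetic, decidable predicates and bounded search\<close>

lemma computable_add [comp]: "f \<le>\<^sub>T A \<Longrightarrow> g \<le>\<^sub>T A \<Longrightarrow> (\<lambda>x. f x + g x) \<le>\<^sub>T A"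
proof (rule computable2[of "\<lambda>a b. a + b"])
  have "rec_nat a (\<lambda>k s. Suc s) n = a + n" for a n :: nat
    by (induction n) auto
  moreover have "(\<lambda>u. rec_nat (pfst u) (\<lambda>k s. Suc s) (psnd u)) \<le>\<^sub>T A"
    by (intro comp)
  ultimately show "(\<lambda>u. pfst u + psnd u) \<le>\<^sub>T A"
    by (simp only:)
qed

lemma computable_diff [comp]: "f \<le>\<^sub>T A \<Longrightarrow> g \<le>\<^sub>T A \<Longrightarrow> (\<lambda>x. f x - g x) \<le>\<^sub>T A"
proof (rule computable2[of "\<lambda>a b. a - b"])
  have "rec_nat 0 (\<lambda>k s. k) n = n - 1" for n :: nat
    by (cases n) auto
  moreover have "(\<lambda>n. rec_nat 0 (\<lambda>k s. k) n) \<le>\<^sub>T A"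
    by (intro comp)
  ultimately have pred: "(\<lambda>n. n - 1) \<le>\<^sub>T A"
    by (simp only:)
  have "rec_nat a (\<lambda>k s. s - 1) n = a - n" for a n :: nat
    by (induction n) auto
  moreover have "(\<lambda>u. rec_nat (pfst u) (\<lambda>k s. s - 1) (psnd u)) \<le>\<^sub>T A"
    by (intro comp computable_compose[OF pred])
  ultimately show "(\<lambda>u. pfst u - psnd u) \<le>\<^sub>T A"
    by (simp only:)
qed

lemma computable_mult [comp]: "f \<le>\<^sub>T A \<Longrightarrow> g \<le>\<^sub>T A \<Longrightarrow> (\<lambda>x. f x * g x) \<le>\<^sub>T A"
proof (rule computable2[of "\<lambda>a b. a * b"])
  have "rec_nat 0 (\<lambda>k s. s + a) n = a * n" for a n :: nat
    by (induction n) auto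
  moreover have "(\<lambda>u. rec_nat 0 (\<lambda>k s. s + pfst u) (psnd u)) \<le>\<^sub>T A"
    by (intro comp)
  ultimately show "(\<lambda>u. pfst u * psnd u) \<le>\<^sub>T A"
    by (simp only:)
qed

lemma computable_power [comp]: "f \<le>\<^sub>T A \<Longrightarrow> g \<le>\<^sub>T A \<Longrightarrow> (\<lambda>x. f x ^ g x) \<le>\<^sub>T A"
proof (rule computable2[of "\<lambda>a b. a ^ b"])
  have "rec_nat 1 (\<lambda>k s. s * a) n = a ^ n" for a n :: nat
    by (induction n) auto
  moreover have "(\<lambda>u. rec_nat 1 (\<lambda>k s. s * pfst u) (psnd u)) \<le>\<^sub>T A"
    by (intro comp)
  ultimately show "(\<lambda>u. pfst u ^ psnd u) \<le>\<^sub>T A"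
    by (simp only:)
qed

lemma computable_of_bool [comp]: "decidable_in A P \<Longrightarrow> (\<lambda>x. of_bool (P x)) \<le>\<^sub>T A"
  unfolding decidable_in_def .

lemma decidable_const [comp]: "decidable_in A (\<lambda>_. c)"
  unfolding decidable_in_def by (rule comp)

lemma decidable_not [comp]: "decidable_in A P \<Longrightarrow> decidable_in A (\<lambda>x. \<not> P x)"
proof -
  assume P: "decidable_in A P"
  have "(\<lambda>x. 1 - of_bool (P x)) \<le>\<^sub>T A"
    by (intro comp P)
  moreover have "(\<lambda>x. 1 - of_bool (P x)) = (\<lambda>x. of_bool (\<not> P x) :: nat)"
    by auto
  ultimately show ?thesis
    unfolding decidable_in_def by metis
qed

lemma decidable_conj [comp]:
  "decidable_in A P \<Longrightarrow> decidable_in A Q \<Longrightarrow> decidable_in A (\<lambda>x. P x \<and> Q x)"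
  unfolding decidable_in_def of_bool_conj by (rule computable_mult)

lemma decidable_disj [comp]:
  "decidable_in A P \<Longrightarrow> decidable_in A Q \<Longrightarrow> decidable_in A (\<lambda>x. P x \<or> Q x)"
  using decidable_not[OF decidable_conj[OF decidable_not decidable_not], of A P Q] by simp

lemma decidable_imp [comp]:
  "decidable_in A P \<Longrightarrow> decidable_in A Q \<Longrightarrow> decidable_in A (\<lambda>x. P x \<longrightarrow> Q x)"
  unfolding imp_conv_disj by (intro comp)

lemma decidable_less [comp]: "f \<le>\<^sub>T A \<Longrightarrow> g \<le>\<^sub>T A \<Longrightarrow> decidable_in A (\<lambda>x. f x < g x)"
proof -
  assume fg: "f \<le>\<^sub>T A" "g \<le>\<^sub>T A"
  \<comment> \<open>With truncated subtraction, \<open>1 - (1 - d)\<close> is 0 for d = 0 and 1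
    otherwise.\<close>
  have "(\<lambda>x. 1 - (1 - (g x - f x))) \<le>\<^sub>T A"
    by (intro comp fg)
  moreover have "(\<lambda>x. 1 - (1 - (g x - f x))) = (\<lambda>x. of_bool (f x < g x) :: nat)"
    by auto
  ultimately show ?thesis
    unfolding decidable_in_def by metis
qed

lemma decidable_le [comp]: "f \<le>\<^sub>T A \<Longrightarrow> g \<le>\<^sub>T A \<Longrightarrow> decidable_in A (\<lambda>x. f x \<le> g x)"
  unfolding not_less[symmetric] by (intro comp)

lemma decidable_eq [comp]: "f \<le>\<^sub>T A \<Longrightarrow> g \<le>\<^sub>T A \<Longrightarrow> decidable_in A (\<lambda>x. f x = g x)"
  for f g :: "nat \<Rightarrow> nat"
  unfolding order.eq_iff by (intro comp)

lemma computable_if [comp]: "decidable_in A P \<Longrightarrow> f \<le>\<^sub>T A \<Longrightarrow> g \<le>\<^sub>T A \<Longrightarrow>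
    (\<lambda>x. if P x then f x else g x) \<le>\<^sub>T A"
proof -
  assume a: "decidable_in A P" "f \<le>\<^sub>T A" "g \<le>\<^sub>T A"
  have "(\<lambda>x. of_bool (P x) * f x + of_bool (\<not> P x) * g x) \<le>\<^sub>T A"
    by (intro comp a)
  moreover have "(\<lambda>x. of_bool (P x) * f x + of_bool (\<not> P x) * g x) = (\<lambda>x. if P x then f x else g x)"
    by auto
  ultimately show ?thesis
    by metis
qed

lemma computable_sum [comp]:
  assumes "b \<le>\<^sub>T A" "(\<lambda>u. f (pfst u) (psnd u)) \<le>\<^sub>T A"
  shows "(\<lambda>x. \<Sum>i<b x. f x i) \<le>\<^sub>T A"
proof -
  have "rec_nat 0 (\<lambda>k s. s + f x k) n = (\<Sum>i<n. f x i)" for x n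
    by (induction n) auto
  moreover have "(\<lambda>x. rec_nat 0 (\<lambda>k s. s + f x k) (b x)) \<le>\<^sub>T A"
    by (intro comp assms computable2[OF assms(2)])
  ultimately show ?thesis
    by (simp only:)
qed

lemma computable_card [comp]:
  assumes "b \<le>\<^sub>T A" "decidable2_in A P"
  shows "(\<lambda>x. card {c. c < b x \<and> P x c}) \<le>\<^sub>T A"
proof -
  have "(\<Sum>c<n. of_bool (P x c)) = card {c. c < n \<and> P x c}" for x n
    by (simp add: of_bool_def sum.If_cases Int_def lessThan_def)
  moreover have "(\<lambda>x. \<Sum>c<b x. of_bool (P x c)) \<le>\<^sub>T A"
    by (intro comp assms)
  ultimately show ?thesis
    by (simp only:)
qed

lemma decidable_bex [comp]:
  assumes "b \<le>\<^sub>T A" "decidable2_in A P"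
  shows "decidable_in A (\<lambda>x. \<exists>z<b x. P x z)"
proof -
  have "0 < card {c. c < n \<and> P x c} \<longleftrightarrow> (\<exists>z<n. P x z)" for x n
    by (auto simp: card_gt_0_iff)
  moreover have "decidable_in A (\<lambda>x. 0 < card {c. c < b x \<and> P x c})"
    by (intro comp assms)
  ultimately show ?thesis
    by (simp only:)
qed

lemma decidable_bex_le [comp]: "b \<le>\<^sub>T A \<Longrightarrow> decidable2_in A P \<Longrightarrow>
    decidable_in A (\<lambda>x. \<exists>z\<le>b x. P x z)"
  unfolding less_Suc_eq_le[symmetric] by (intro comp)

lemma decidable_ball [comp]:
  assumes "b \<le>\<^sub>T A" "decidable2_in A P"
  shows "decidable_in A (\<lambda>x. \<forall>z<b x. P x z)"
proof -
  have "decidable_in A (\<lambda>x. \<not> (\<exists>z<b x. \<not> P x z))"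
    by (intro comp assms)
  then show ?thesis
    by simp
qed

lemma decidable_ball_le [comp]: "b \<le>\<^sub>T A \<Longrightarrow> decidable2_in A P \<Longrightarrow>
    decidable_in A (\<lambda>x. \<forall>z\<le>b x. P x z)"
  unfolding less_Suc_eq_le[symmetric] by (intro comp)

lemma computable_div [comp]: "f \<le>\<^sub>T A \<Longrightarrow> g \<le>\<^sub>T A \<Longrightarrow> (\<lambda>x. f x div g x) \<le>\<^sub>T A"
proof (rule computable2[of "\<lambda>a b. a div b"])
  \<comment> \<open>The quotient is obtained by counting the positive multiples of \<open>n\<close>
    up to \<open>a\<close>. For n = 0 the count would be \<open>a\<close>, whereas
    \<open>a div 0 = 0\<close>.\<close>
  have "a div n = (if n = 0 then 0 else card {q. q < a \<and> Suc q * n \<le> a})" for a n :: nat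
  proof (cases "n = 0")
    case False
    have "{q. q < a \<and> Suc q * n \<le> a} = {..<a div n}"
    proof (intro set_eqI iffI; clarsimp)
      fix q assume "n + q * n \<le> a"
      then have "Suc q * n \<le> a" by simp
      then show "q < a div n"
        using False by (metis Suc_le_eq div_le_mono nonzero_mult_div_cancel_right)
    next
      fix q assume "q < a div n"
      then have "Suc q * n \<le> a"
        by (metis Suc_leI div_times_less_eq_dividend le_trans mult_le_mono1)
      moreover have "Suc q \<le> Suc q * n"
        using False by (metis One_nat_def Suc_leI mult_le_mono2 nat_mult_1_right neq0_conv)
      ultimately show "q < a \<and> n + q * n \<le> a"
        by (simp add: Suc_le_eq)
    qed
    then show ?thesis
      using False by simp
  qed simp
  moreover have "(\<lambda>u. if psnd u = 0 then 0
      else card {q. q < pfst u \<and> Suc q * psnd u \<le> pfst u}) \<le>\<^sub>T A"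
    by (intro comp)
  ultimately show "(\<lambda>u. pfst u div psnd u) \<le>\<^sub>T A"
    by (simp only:)
qed

lemma computable_mod [comp]: "f \<le>\<^sub>T A \<Longrightarrow> g \<le>\<^sub>T A \<Longrightarrow> (\<lambda>x. f x mod g x) \<le>\<^sub>T A"
  unfolding modulo_nat_def by (intro comp)

lemma decidable_bit [comp]: "f \<le>\<^sub>T A \<Longrightarrow> g \<le>\<^sub>T A \<Longrightarrow> decidable_in A (\<lambda>x. bit (f x) (g x))"
  for f g :: "nat \<Rightarrow> nat"
  unfolding bit_iff_odd odd_iff_mod_2_eq_one by (intro comp)

lemma computable_Least:
  assumes "decidable2_in A P" "\<And>x. \<exists>y. P x y"
  shows "(\<lambda>x. LEAST y. P x y) \<le>\<^sub>T A"
proof -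
  \<comment> \<open>\<open>Minim\<close> searches for the first zero, so it has to run on the
    characteristic function of the negation.\<close>
  have "decidable2_in A (\<lambda>x y. \<not> P x y)"
    by (intro comp assms)
  then obtain p where p: "\<And>u. eval A p u (of_bool (\<not> P (pfst u) (psnd u)))"
    unfolding decidable_in_def computable_in_def by auto
  have "eval A (Minim p) x (LEAST y. P x y)" for x
  proof (rule eval_minim)
    fix z assume "z < (LEAST y. P x y)"
    then have "\<not> P x z"
      by (rule not_less_Least)
    then show "\<exists>v. eval A p (prod_encode (x, z)) (Suc v)"
      using p[of "prod_encode (x, z)"] by auto
  next
    have "P x (LEAST y. P x y)"
      using assms(2) LeastI_ex by metis
    then show "eval A p (prod_encode (x, LEAST y. P x y)) 0"
      using p[of "prod_encode (x, LEAST y. P x y)"] by auto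
  qed
  then show ?thesis
    unfolding computable_in_def by auto
qed

section \<open>Coding of initial segments\<close>

text \<open>Bit \<open>i\<close> of \<open>rst X k\<close> is \<open>X i\<close>; thus \<open>bit c\<close> is the oracle extending the string coded by \<open>c\<close> with zeros.\<close>

definition rst :: "cantor \<Rightarrow> nat \<Rightarrow> nat" where
  "rst X k = (\<Sum>i<k. of_bool (X i) * 2 ^ i)"

lemma rst_horner: "rst X k = horner_sum of_bool 2 (map X [0..<k])"
  by (simp add: horner_sum_eq_sum rst_def atLeast0LessThan)

lemma bit_rst [simp]: "bit (rst X k) i \<longleftrightarrow> i < k \<and> X i"
  unfolding rst_horner by (auto simp: bit_horner_sum_bit_iff)

lemma rst_bit: "rst (bit c) k = take_bit k c" for c :: nat
  unfolding rst_horner by (rule horner_sum_bit_eq_take_bit)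

lemma rst_bit_less [simp]: "c < 2 ^ k \<Longrightarrow> rst (bit c) k = c"
  by (simp add: rst_bit take_bit_nat_eq_self)

lemma rst_cong: "(\<And>i. i < k \<Longrightarrow> X i = Y i) \<Longrightarrow> rst X k = rst Y k"
  by (auto simp: rst_def)

lemma rst_eq_iff: "rst X k = rst Y k \<longleftrightarrow> (\<forall>i<k. X i = Y i)"
  by (metis bit_rst rst_cong)

lemma rst_less [simp]: "rst X k < 2 ^ k"
  unfolding rst_horner by (metis horner_sum_of_bool_2_less length_map length_upt diff_zero)

lemma rst_bit_rst [simp]: "j \<le> k \<Longrightarrow> rst (bit (rst X k)) j = rst X j"
  by (rule rst_cong) simp

lemma computable_rst [comp]:
  assumes "decidable2_in A P" "k \<le>\<^sub>T A"
  shows "(\<lambda>x. rst (P x) (k x)) \<le>\<^sub>T A"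
  unfolding rst_def by (intro comp assms)

lemma prefix_code_cong: "(\<And>i. i < k \<Longrightarrow> X i = Y i) \<Longrightarrow> prefix_code X k = prefix_code Y k"
  unfolding prefix_code_def by (intro arg_cong[where f = list_encode] map_cong) auto

lemma prefix_code_rst [simp]: "j \<le> k \<Longrightarrow> prefix_code (bit (rst X k)) j = prefix_code X j"
  by (rule prefix_code_cong) simp

text \<open>A prefix code determines the length of the string, while trailing zeros are invisible in
  \<open>rst\<close>. For this reason the length accompanies \<open>rst X k\<close> wherever the two
  codings are exchanged.\<close>

lemma prefix_code_eq_iff:
  "prefix_code X k = prefix_code Y j \<longleftrightarrow> k = j \<and> rst X k = rst Y j"
proof -
  have "map (\<lambda>i. of_bool (X i) :: nat) [0..<k] = map (\<lambda>i. of_bool (Y i)) [0..<j]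
      \<longleftrightarrow> k = j \<and> (\<forall>i<k. X i = Y i)"
    by (auto simp: list_eq_iff_nth_eq)
  then show ?thesis
    unfolding prefix_code_def list_encode_eq by (auto simp: rst_eq_iff)
qed

lemma computable_prefix_code [comp]:
  assumes "decidable2_in A P" "k \<le>\<^sub>T A"
  shows "(\<lambda>x. prefix_code (P x) (k x)) \<le>\<^sub>T A"
proof -
  \<comment> \<open>\<open>list_encode\<close> unfolds at the head, so the recursion builds the list
    from its last entry backwards.\<close>
  have "list_encode (map (\<lambda>i. of_bool (X i)) [n - j..<n]) =
      rec_nat 0 (\<lambda>i s. Suc (prod_encode (of_bool (X (n - Suc i)), s))) j" if "j \<le> n" for X n j
    using that
  proof (induction j)
    case (Suc j)
    then have "[n - Suc j..<n] = (n - Suc j) # [n - j..<n]"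
      by (metis Suc_diff_Suc Suc_le_lessD diff_less upt_conv_Cons zero_less_Suc order.strict_trans1 le0)
    with Suc show ?case
      by simp
  qed simp
  from this[of k k for k]
  have "prefix_code X n = rec_nat 0 (\<lambda>i s. Suc (prod_encode (of_bool (X (n - Suc i)), s))) n" for X n
    unfolding prefix_code_def by simp
  then show ?thesis
    by (simp only:) (intro comp decidable2[OF assms(1)] assms(2) computable_compose[OF assms(2)])
qed

section \<open>A universal machine\<close>

abbreviation fact3 :: "nat \<Rightarrow> nat \<Rightarrow> nat \<Rightarrow> nat" where
  "fact3 e n r \<equiv> prod_encode (e, prod_encode (n, r))"

text \<open>
  \<open>fact3 e n r\<close> stands for the assertion that program number \<open>e\<close> maps \<open>n\<close> to \<open>r\<close>.  Stage \<open>s + 1\<close>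
  collects the facts with code below \<open>s\<close> that follow in one step from those of stage \<open>s\<close>; each
  stage is finite and depends on finitely many oracle values only.
\<close>

definition justified :: "cantor \<Rightarrow> (nat \<Rightarrow> bool) \<Rightarrow> nat \<Rightarrow> nat \<Rightarrow> nat \<Rightarrow> nat \<Rightarrow> bool" where
  "justified A F s e n r \<longleftrightarrow>
     e = 0 \<and> r = 0 \<or> e = 1 \<and> r = Suc n \<or> e = 2 \<and> r = pfst n \<or> e = 3 \<and> r = psnd n
   \<or> e = 4 \<and> r = of_bool (A n)
   \<or> 5 \<le> e \<and> (e - 5) mod 4 = 0 \<and>
      F (fact3 (pfst ((e - 5) div 4)) n (pfst r)) \<and> F (fact3 (psnd ((e - 5) div 4)) n (psnd r))
   \<or> 5 \<le> e \<and> (e - 5) mod 4 = 1 \<and>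
      (\<exists>a<s. F (fact3 (psnd ((e - 5) div 4)) n a) \<and> F (fact3 (pfst ((e - 5) div 4)) a r))
   \<or> 5 \<le> e \<and> (e - 5) mod 4 = 2 \<and>
      (psnd n = 0 \<and> F (fact3 (pfst ((e - 5) div 4)) (pfst n) r)
       \<or> (\<exists>k<s. \<exists>v<s. psnd n = Suc k \<and> F (fact3 e (prod_encode (pfst n, k)) v) \<and>
            F (fact3 (psnd ((e - 5) div 4)) (prod_encode (pfst n, prod_encode (k, v))) r)))
   \<or> 5 \<le> e \<and> (e - 5) mod 4 = 3 \<and>
      F (fact3 ((e - 5) div 4) (prod_encode (n, r)) 0) \<and>
      (\<forall>z<r. \<exists>v<s. F (fact3 ((e - 5) div 4) (prod_encode (n, z)) (Suc v)))"

lemma justified_simps [simp]: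
  "justified A F s 0 n r \<longleftrightarrow> r = 0"
  "justified A F s (Suc 0) n r \<longleftrightarrow> r = Suc n"
  "justified A F s 2 n r \<longleftrightarrow> r = pfst n"
  "justified A F s 3 n r \<longleftrightarrow> r = psnd n"
  "justified A F s 4 n r \<longleftrightarrow> r = of_bool (A n)"
  "justified A F s (5 + 4 * m) n r \<longleftrightarrow>
     F (fact3 (pfst m) n (pfst r)) \<and> F (fact3 (psnd m) n (psnd r))"
  "justified A F s (6 + 4 * m) n r \<longleftrightarrow>
     (\<exists>a<s. F (fact3 (psnd m) n a) \<and> F (fact3 (pfst m) a r))"
  "justified A F s (7 + 4 * m) n r \<longleftrightarrow>
     psnd n = 0 \<and> F (fact3 (pfst m) (pfst n) r)
     \<or> (\<exists>k<s. \<exists>v<s. psnd n = Suc k \<and> F (fact3 (7 + 4 * m) (prod_encode (pfst n, k)) v) \<and>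
          F (fact3 (psnd m) (prod_encode (pfst n, prod_encode (k, v))) r))"
  "justified A F s (8 + 4 * m) n r \<longleftrightarrow>
     F (fact3 m (prod_encode (n, r)) 0) \<and>
     (\<forall>z<r. \<exists>v<s. F (fact3 m (prod_encode (n, z)) (Suc v)))"
proof -
  have d: "(k + 4 * m) div 4 = m" "(k + 4 * m) mod 4 = k" if "k < 4" for k m :: nat
    using that by simp_all
  have e: "5 + 4 * m - 5 = 0 + 4 * m" "6 + 4 * m - 5 = 1 + 4 * m" "7 + 4 * m - 5 = 2 + 4 * m"
    "8 + 4 * m - 5 = 3 + 4 * m" for m :: nat
    by simp_all
  have lt: "0 < (4::nat)" "1 < (4::nat)" "2 < (4::nat)" "3 < (4::nat)"
    by simp_all
  note * = e d[OF lt(1)] d[OF lt(2)] d[OF lt(3)] d[OF lt(4)]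
  show "justified A F s (5 + 4 * m) n r \<longleftrightarrow>
     F (fact3 (pfst m) n (pfst r)) \<and> F (fact3 (psnd m) n (psnd r))"
   "justified A F s (6 + 4 * m) n r \<longleftrightarrow>
     (\<exists>a<s. F (fact3 (psnd m) n a) \<and> F (fact3 (pfst m) a r))"
   "justified A F s (7 + 4 * m) n r \<longleftrightarrow>
     psnd n = 0 \<and> F (fact3 (pfst m) (pfst n) r)
     \<or> (\<exists>k<s. \<exists>v<s. psnd n = Suc k \<and> F (fact3 (7 + 4 * m) (prod_encode (pfst n, k)) v) \<and>
          F (fact3 (psnd m) (prod_encode (pfst n, prod_encode (k, v))) r))"
   "justified A F s (8 + 4 * m) n r \<longleftrightarrow>
     F (fact3 m (prod_encode (n, r)) 0) \<and>
     (\<forall>z<r. \<exists>v<s. F (fact3 m (prod_encode (n, z)) (Suc v)))"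
    unfolding justified_def * by simp_all
qed (simp_all add: justified_def)

text \<open>\<open>F\<close> occurs only positively, and \<open>s\<close> only as a bound of
  existential quantifiers; the universal quantifier of the \<open>Minim\<close> clause is bounded by
  \<open>r\<close>.\<close>

lemma justified_mono:
  assumes "justified A F s e n r" "\<And>u. F u \<Longrightarrow> G u" "s \<le> t"
  shows "justified A G t e n r"
proof -
  have ex: "(\<exists>a<s. P a) \<longrightarrow> (\<exists>a<t. Q a)" if "\<And>a. P a \<longrightarrow> Q a" for P Q
    using that assms(3) less_le_trans by blast
  have all: "(\<forall>z<r. P z) \<longrightarrow> (\<forall>z<r. Q z)" if "\<And>a. P a \<longrightarrow> Q a" for P Q
    using that by blast
  have FG: "F u \<longrightarrow> G u" for u
    using assms(2) by blast
  have "justified A F s e n r \<longrightarrow> justified A G t e n r"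
    unfolding justified_def by (intro conj_mono disj_mono ex all FG imp_refl)
  with assms(1) show ?thesis by blast
qed

lemma justified_cong:
  assumes "A n = B n"
  shows "justified A F s e n r \<longleftrightarrow> justified B F s e n r"
  unfolding justified_def using assms by simp

lemma decidable_justified:
  assumes "decidable2_in A P" "c \<le>\<^sub>T A" "s \<le>\<^sub>T A" "e \<le>\<^sub>T A" "n \<le>\<^sub>T A" "r \<le>\<^sub>T A"
  shows "decidable_in A (\<lambda>x. justified (P x) (bit (c x)) (s x) (e x) (n x) (r x))"
  unfolding justified_def
  by (intro comp assms decidable2[OF assms(1)] computable_compose[OF assms(2)]
      computable_compose[OF assms(3)] computable_compose[OF assms(4)]
      computable_compose[OF assms(5)] computable_compose[OF assms(6)])

primrec facts :: "cantor \<Rightarrow> nat \<Rightarrow> nat \<Rightarrow> bool" where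
  "facts A 0 = (\<lambda>_. False)"
| "facts A (Suc s) =
    (\<lambda>u. u < s \<and> justified A (facts A s) s (pfst u) (pfst (psnd u)) (psnd (psnd u)))"

lemma facts_less: "facts A s u \<Longrightarrow> u < s"
  by (cases s) auto

lemma facts_Suc: "facts A s u \<Longrightarrow> facts A (Suc s) u"
proof (induction s arbitrary: u)
  case (Suc s)
  from Suc.prems have u: "u < s" and
    j: "justified A (facts A s) s (pfst u) (pfst (psnd u)) (psnd (psnd u))"
    by simp_all
  have "justified A (facts A (Suc s)) (Suc s) (pfst u) (pfst (psnd u)) (psnd (psnd u))"
    by (rule justified_mono[OF j]) (simp_all only: Suc.IH le_Suc_eq simp_thms order.refl)
  with u show ?case
    unfolding facts.simps(2)[of A "Suc s"] by simp
qed simp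

lemma facts_mono: "facts A s u \<Longrightarrow> s \<le> t \<Longrightarrow> facts A t u"
  by (induction t) (auto simp del: facts.simps(2) elim: le_SucE intro: facts_Suc)

text \<open>The use principle: a fact present at stage \<open>s\<close> has a code below
  \<open>s\<close>, and a derivation step consults the oracle only at the input, which is at most
  that code.\<close>

lemma facts_cong: "(\<And>i. i < s \<Longrightarrow> A i = B i) \<Longrightarrow> facts A s = facts B s"
proof (induction s)
  case (Suc s)
  then have IH: "facts A s = facts B s"
    by simp
  have "justified A F s (pfst u) (pfst (psnd u)) (psnd (psnd u)) \<longleftrightarrow>
      justified B F s (pfst u) (pfst (psnd u)) (psnd (psnd u))" if "u < s" for F u
  proof (rule justified_cong, rule Suc.prems)
    have "pfst (psnd u) \<le> psnd u" "psnd u \<le> u"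
      by (metis le_prod_encode_1 pair_pfst_psnd) (metis le_prod_encode_2 pair_pfst_psnd)
    with that show "pfst (psnd u) < Suc s"
      by linarith
  qed
  with IH show ?case
    by auto
qed simp

lemma facts_eq_bit: "facts A s = bit (rst (facts A s) s)"
  using facts_less by auto

lemma decidable_facts [comp]:
  assumes "decidable2_in A P" "s \<le>\<^sub>T A" "u \<le>\<^sub>T A"
  shows "decidable_in A (\<lambda>x. facts (P x) (s x) (u x))"
proof -
  \<comment> \<open>A stage is a finite set, hence the bit set of one number, and the sequence of
    these numbers is primitive recursive in the oracle.\<close>
  have "rec_nat 0 (\<lambda>k c. rst (\<lambda>u. u < k \<and>
      justified X (bit c) k (pfst u) (pfst (psnd u)) (psnd (psnd u))) (Suc k)) m = rst (facts X m) m" for X m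
  proof (induction m)
    case (Suc m)
    then show ?case
      by (simp add: facts_eq_bit[symmetric])
  qed (simp add: rst_def)
  moreover have "(\<lambda>x. rec_nat 0 (\<lambda>k c. rst (\<lambda>u. u < k \<and>
      justified (P x) (bit c) k (pfst u) (pfst (psnd u)) (psnd (psnd u))) (Suc k)) (s x)) \<le>\<^sub>T A"
    by (intro comp decidable_justified decidable2[OF assms(1)] assms)
  ultimately have "(\<lambda>x. rst (facts (P x) (s x)) (s x)) \<le>\<^sub>T A"
    by (simp only:)
  from decidable_bit[OF this assms(3)] show ?thesis
    by (simp only: facts_eq_bit[symmetric])
qed

lemma facts_sound: "facts A s (fact3 (index p) n r) \<Longrightarrow> eval A p n r"
proof (induction s arbitrary: p n r)
  case (Suc s)
  then have j: "justified A (facts A s) s (index p) n r"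
    by simp
  note IH = Suc.IH
  show ?case
  proof (cases p)
    case (Pairing p1 p2)
    with j have "facts A s (fact3 (index p1) n (pfst r))" "facts A s (fact3 (index p2) n (psnd r))"
      by simp_all
    from eval_pairing[OF this[THEN IH]] show ?thesis
      using Pairing by simp
  next
    case (Compose p1 p2)
    with j obtain a where "facts A s (fact3 (index p2) n a)" "facts A s (fact3 (index p1) a r)"
      by auto
    from eval_compose[OF this[THEN IH]] show ?thesis
      using Compose by simp
  next
    case (PrimRec p1 p2)
    with j consider "psnd n = 0" "facts A s (fact3 (index p1) (pfst n) r)"
      | k v where "psnd n = Suc k" "facts A s (fact3 (index p) (prod_encode (pfst n, k)) v)"
        "facts A s (fact3 (index p2) (prod_encode (pfst n, prod_encode (k, v))) r)"
      by (auto simp del: justified_simps(8) simp: justified_simps(8)[of _ _ _ "prod_encode (index p1, index p2)"])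
    then show ?thesis
    proof cases
      case 1
      from eval_primrec_0[OF 1(2)[THEN IH], of p2] 1(1) PrimRec show ?thesis
        by (metis pair_pfst_psnd)
    next
      case 2
      from 2(2)[THEN IH] PrimRec eval_primrec_Suc[OF _ 2(3)[THEN IH], of p1] 2(1) show ?thesis
        by (metis pair_pfst_psnd)
    qed
  next
    case (Minim p1)
    with j have "facts A s (fact3 (index p1) (prod_encode (n, r)) 0)"
      "\<And>z. z < r \<Longrightarrow> \<exists>v. facts A s (fact3 (index p1) (prod_encode (n, z)) (Suc v))"
      by auto
    then show ?thesis
      unfolding Minim by (intro eval_minim) (blast intro: IH)+
  next
    case OracleP
    with j eval_oracle[of A n] show ?thesis
      by simp
  qed (use j in \<open>auto simp: pfst_def psnd_def intro: eval.intros\<close>)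
qed simp

text \<open>The next stage admits only facts with small codes, so it may be necessary to wait until
  the stage exceeds the code of the conclusion.\<close>

lemma facts_intro:
  assumes "justified A (facts A s) s e n r"
  shows "\<exists>t. facts A t (fact3 e n r)"
proof -
  define t where "t = max s (Suc (fact3 e n r))"
  have "justified A (facts A t) t e n r"
    by (rule justified_mono[OF assms]) (auto simp: t_def intro: facts_mono)
  then have "facts A (Suc t) (fact3 e n r)"
    by (auto simp: t_def)
  then show ?thesis ..
qed

lemma fact3_bounds: "facts A s (fact3 e n r) \<Longrightarrow> n < s \<and> r < s"
  by (meson facts_less le_less_trans le_prod_encode_1 le_prod_encode_2)

text \<open>By induction on the computation: the finitely many premises appear at various stages and
  are moved to a common one. Intermediate values are below that stage by
  \<open>fact3_bounds\<close>, so the bounded quantifiers of \<open>justified\<close> find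
  them.\<close>

lemma facts_complete: "eval A p n r \<Longrightarrow> \<exists>s. facts A s (fact3 (index p) n r)"
proof (induction rule: eval.induct)
  case (eval_pairing p n a q b)
  then obtain s t where "facts A s (fact3 (index p) n a)" "facts A t (fact3 (index q) n b)"
    by auto
  then have "facts A (max s t) (fact3 (index p) n a)" "facts A (max s t) (fact3 (index q) n b)"
    by (auto intro: facts_mono)
  then show ?case
    by (intro facts_intro[of _ "max s t"]) simp
next
  case (eval_compose q n a p r)
  then obtain s t where "facts A s (fact3 (index q) n a)" "facts A t (fact3 (index p) a r)"
    by auto
  then have *: "facts A (max s t) (fact3 (index q) n a)" "facts A (max s t) (fact3 (index p) a r)"
    by (auto intro: facts_mono)
  then have "\<exists>a<max s t. facts A (max s t) (fact3 (index q) n a) \<and>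
      facts A (max s t) (fact3 (index p) a r)"
    using fact3_bounds by blast
  then show ?case
    by (intro facts_intro[of _ "max s t"]) simp
next
  case (eval_primrec_0 p a r q)
  then obtain s where "facts A s (fact3 (index p) a r)" by auto
  then show ?case
    by (intro facts_intro[of _ s]) simp
next
  case (eval_primrec_Suc p q a k v r)
  then obtain s t where *: "facts A s (fact3 (index (PrimRec p q)) (prod_encode (a, k)) v)"
    "facts A t (fact3 (index q) (prod_encode (a, prod_encode (k, v))) r)"
    by auto
  define m where "m = max s t"
  have **: "facts A m (fact3 (index (PrimRec p q)) (prod_encode (a, k)) v)"
    "facts A m (fact3 (index q) (prod_encode (a, prod_encode (k, v))) r)"
    using * by (auto intro: facts_mono simp: m_def simp del: index.simps)
  then have "prod_encode (a, k) < m" "v < m"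
    using fact3_bounds by auto
  then have "k < m" "v < m"
    using le_less_trans[OF le_prod_encode_2] by auto
  with ** show ?case
    by (intro facts_intro[of _ m]) auto
next
  case (eval_minim y p a)
  have "\<exists>v s. z < y \<longrightarrow> facts A s (fact3 (index p) (prod_encode (a, z)) (Suc v))" for z
    using eval_minim(1)[of z] by auto
  then obtain v s where vs: "\<And>z. z < y \<Longrightarrow> facts A (s z) (fact3 (index p) (prod_encode (a, z)) (Suc (v z)))"
    by metis
  obtain t where t: "facts A t (fact3 (index p) (prod_encode (a, y)) 0)"
    using eval_minim by auto
  define m where "m = t + (\<Sum>z<y. s z)"
  have "facts A m (fact3 (index p) (prod_encode (a, z)) (Suc (v z)))" if "z < y" for z
  proof (rule facts_mono[OF vs[OF that]])
    have "s z \<le> (\<Sum>z<y. s z)"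
      using that by (intro member_le_sum) auto
    then show "s z \<le> m" by (simp add: m_def)
  qed
  moreover from this have "v z < m" if "z < y" for z
    using that fact3_bounds Suc_lessD by blast
  moreover have "facts A m (fact3 (index p) (prod_encode (a, y)) 0)"
    by (rule facts_mono[OF t]) (simp add: m_def)
  ultimately show ?case
    by (intro facts_intro[of _ m]) auto
qed (auto intro!: facts_intro[of _ 0] simp: pfst_def psnd_def)

text \<open>The bound on \<open>r\<close> makes the search finite and loses nothing by
  \<open>fact3_bounds\<close>. It also makes every halting stage exceed the output, so that a bound
  on convergence times bounds the values of the function.\<close>

definition halts_by :: "cantor \<Rightarrow> nat \<Rightarrow> nat \<Rightarrow> nat \<Rightarrow> bool" where
  "halts_by A e n s \<longleftrightarrow> (\<exists>r<s. facts A s (fact3 e n r))"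

lemma halts_by_mono: "halts_by A e n s \<Longrightarrow> s \<le> t \<Longrightarrow> halts_by A e n t"
  unfolding halts_by_def by (meson facts_mono less_le_trans)

lemma halts_by_cong: "(\<And>i. i < s \<Longrightarrow> A i = B i) \<Longrightarrow> halts_by A e n s \<longleftrightarrow> halts_by B e n s"
  unfolding halts_by_def using facts_cong by metis

lemma halts_by_rst [simp]: "s \<le> k \<Longrightarrow> halts_by (bit (rst A k)) e n s \<longleftrightarrow> halts_by A e n s"
  by (rule halts_by_cong) simp

lemma halts_by_eval: "halts_by A (index p) n s \<Longrightarrow> \<exists>r<s. eval A p n r"
  unfolding halts_by_def using facts_sound by blast

lemma eval_halts_by: "eval A p n r \<Longrightarrow> \<exists>s. halts_by A (index p) n s"
proof -
  assume "eval A p n r"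
  then obtain s where "facts A s (fact3 (index p) n r)"
    using facts_complete by blast
  with fact3_bounds[OF this] show ?thesis
    unfolding halts_by_def by blast
qed

lemma decidable_halts_by [comp]:
  assumes "decidable2_in A P" "e \<le>\<^sub>T A" "n \<le>\<^sub>T A" "s \<le>\<^sub>T A"
  shows "decidable_in A (\<lambda>x. halts_by (P x) (e x) (n x) (s x))"
  unfolding halts_by_def
  by (intro comp assms decidable2[OF assms(1)] computable_compose[OF assms(2)]
      computable_compose[OF assms(3)] computable_compose[OF assms(4)])

lemma eval_det: "eval A p n r \<Longrightarrow> eval A p n r' \<Longrightarrow> r' = r"
proof (induction arbitrary: r' rule: eval.induct)
  case (eval_primrec_0 p a r q)
  from eval_primrec_0.prems show ?case
    by cases (auto intro: eval_primrec_0.IH)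
next
  case (eval_primrec_Suc p q a k s r)
  from eval_primrec_Suc.prems show ?case
    by cases (auto dest: eval_primrec_Suc.IH)
next
  case (eval_minim y p a)
  from eval_minim.prems show ?case
  proof cases
    case eval_minim
    then show ?thesis
      using eval_minim.IH by (metis linorder_neqE_nat nat.distinct(1))
  qed
next
  case (eval_pairing p n a q b)
  from eval_pairing.prems show ?case
    by cases (auto dest: eval_pairing.IH)
next
  case (eval_compose q n a p r)
  from eval_compose.prems show ?case
    by cases (auto dest: eval_compose.IH)
qed (erule eval.cases; simp; fail)+

section \<open>Semidecidable sets and effectively open classes\<close>

definition semidecidable_in :: "cantor \<Rightarrow> (nat \<Rightarrow> bool) \<Rightarrow> bool" where
  "semidecidable_in A P \<longleftrightarrow> (\<exists>Q. decidable2_in A Q \<and> (\<forall>x. P x \<longleftrightarrow> (\<exists>s. Q x s)))"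

lemma semidecidableI:
  "decidable2_in A Q \<Longrightarrow> (\<And>x. P x \<longleftrightarrow> (\<exists>s. Q x s)) \<Longrightarrow> semidecidable_in A P"
  unfolding semidecidable_in_def by blast

text \<open>Halting means having a halting stage, and conversely \<open>Minim\<close> searches
  through all candidate stages.\<close>

lemma ce_in_iff_semidecidable: "ce_in A W \<longleftrightarrow> semidecidable_in A (\<lambda>x. x \<in> W)"
proof
  assume "ce_in A W"
  then obtain p where p: "W = {n. \<exists>r. eval A p n r}"
    unfolding ce_in_def by auto
  have "decidable2_in A (\<lambda>n s. halts_by A (index p) n s)"
    by (intro comp)
  moreover have "x \<in> W \<longleftrightarrow> (\<exists>s. halts_by A (index p) x s)" for x
    unfolding p using halts_by_eval eval_halts_by by blast
  ultimately show "semidecidable_in A (\<lambda>x. x \<in> W)"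
    by (rule semidecidableI)
next
  assume "semidecidable_in A (\<lambda>x. x \<in> W)"
  then obtain Q where Q: "decidable2_in A Q" "\<And>x. x \<in> W \<longleftrightarrow> (\<exists>s. Q x s)"
    unfolding semidecidable_in_def by auto
  have "decidable2_in A (\<lambda>x y. \<not> Q x y)"
    by (intro comp Q)
  then obtain p where p: "\<And>u. eval A p u (of_bool (\<not> Q (pfst u) (psnd u)))"
    unfolding decidable_in_def computable_in_def by auto
  have "x \<in> W \<longleftrightarrow> (\<exists>r. eval A (Minim p) x r)" for x
  proof
    assume "x \<in> W"
    then have ex: "\<exists>s. Q x s"
      using Q by blast
    have "eval A (Minim p) x (LEAST s. Q x s)"
    proof (rule eval_minim)
      fix z assume "z < (LEAST s. Q x s)"
      then show "\<exists>v. eval A p (prod_encode (x, z)) (Suc v)"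
        using p[of "prod_encode (x, z)"] not_less_Least[of z "Q x"] by auto
    next
      show "eval A p (prod_encode (x, LEAST s. Q x s)) 0"
        using p[of "prod_encode (x, LEAST s. Q x s)"] LeastI_ex[OF ex] by auto
    qed
    then show "\<exists>r. eval A (Minim p) x r" ..
  next
    assume "\<exists>r. eval A (Minim p) x r"
    then obtain y where "eval A p (prod_encode (x, y)) 0"
      by (auto elim: eval.cases)
    with p[of "prod_encode (x, y)"] have "of_bool (\<not> Q x y) = (0 :: nat)"
      using eval_det by fastforce
    then show "x \<in> W"
      using Q by auto
  qed
  then show "ce_in A W"
    unfolding ce_in_def by blast
qed

lemma semidecidable_decidable: "decidable_in A P \<Longrightarrow> semidecidable_in A P"
  by (rule semidecidableI[of _ "\<lambda>x s. P x"])
    (auto intro: decidable_compose computable_pfst_plain)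

lemma semidecidable_compose:
  "semidecidable_in A P \<Longrightarrow> g \<le>\<^sub>T A \<Longrightarrow> semidecidable_in A (\<lambda>x. P (g x))"
  unfolding semidecidable_in_def
proof (elim exE conjE)
  fix Q assume g: "g \<le>\<^sub>T A" and Q: "decidable2_in A Q" "\<forall>x. P x \<longleftrightarrow> (\<exists>s. Q x s)"
  then have "decidable2_in A (\<lambda>x s. Q (g x) s)"
    by (intro decidable2[OF Q(1)] comp computable_compose[OF g])
  with Q show "\<exists>Q. decidable2_in A Q \<and> (\<forall>x. P (g x) \<longleftrightarrow> (\<exists>s. Q x s))"
    by (intro exI[of _ "\<lambda>x. Q (g x)"]) auto
qed

lemma semidecidable_ex:
  assumes "semidecidable_in A (\<lambda>u. P (pfst u) (psnd u))"
  shows "semidecidable_in A (\<lambda>x. \<exists>y. P x y)"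
proof -
  obtain Q where Q: "decidable2_in A Q" "\<And>u. P (pfst u) (psnd u) \<longleftrightarrow> (\<exists>s. Q u s)"
    using assms unfolding semidecidable_in_def by auto
  have P: "P x y \<longleftrightarrow> (\<exists>s. Q (prod_encode (x, y)) s)" for x y
    using Q(2)[of "prod_encode (x, y)"] by simp
  have "decidable2_in A (\<lambda>x s. Q (prod_encode (x, pfst s)) (psnd s))"
    by (intro comp decidable2[OF Q(1)])
  moreover have "(\<exists>y. P x y) \<longleftrightarrow> (\<exists>s. Q (prod_encode (x, pfst s)) (psnd s))" for x
    unfolding P by (metis pfst_pair psnd_pair)
  ultimately show ?thesis
    by (rule semidecidableI)
qed

lemma semidecidable_conj:
  assumes "semidecidable_in A P" "semidecidable_in A Q"
  shows "semidecidable_in A (\<lambda>x. P x \<and> Q x)"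
proof -
  obtain P' Q' where P: "decidable2_in A P'" "\<And>u. P u \<longleftrightarrow> (\<exists>s. P' u s)"
    and Q: "decidable2_in A Q'" "\<And>u. Q u \<longleftrightarrow> (\<exists>s. Q' u s)"
    using assms unfolding semidecidable_in_def by metis
  have "decidable2_in A (\<lambda>x s. P' x (pfst s) \<and> Q' x (psnd s))"
    by (intro comp decidable2[OF P(1)] decidable2[OF Q(1)])
  moreover have "P x \<and> Q x \<longleftrightarrow> (\<exists>s. P' x (pfst s) \<and> Q' x (psnd s))" for x
    unfolding P Q by (metis pfst_pair psnd_pair)
  ultimately show ?thesis
    by (rule semidecidableI)
qed

lemma semidecidable_disj:
  assumes "semidecidable_in A P" "semidecidable_in A Q"
  shows "semidecidable_in A (\<lambda>x. P x \<or> Q x)"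
proof -
  obtain P' Q' where P: "decidable2_in A P'" "\<And>u. P u \<longleftrightarrow> (\<exists>s. P' u s)"
    and Q: "decidable2_in A Q'" "\<And>u. Q u \<longleftrightarrow> (\<exists>s. Q' u s)"
    using assms unfolding semidecidable_in_def by metis
  have "decidable2_in A (\<lambda>x s. P' x s \<or> Q' x s)"
    by (intro comp decidable2[OF P(1)] decidable2[OF Q(1)])
  then show ?thesis
    by (rule semidecidableI) (use P Q in auto)
qed

lemma semidecidable_monotone_stages:
  assumes "semidecidable_in A P"
  obtains Q where "decidable2_in A Q" "\<And>x. P x \<longleftrightarrow> (\<exists>s. Q x s)"
    "\<And>x s t. Q x s \<Longrightarrow> s \<le> t \<Longrightarrow> Q x t"
proof -
  obtain Q where Q: "decidable2_in A Q" "\<And>u. P u \<longleftrightarrow> (\<exists>s. Q u s)"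
    using assms unfolding semidecidable_in_def by metis
  show thesis
  proof
    show "decidable2_in A (\<lambda>x t. \<exists>s\<le>t. Q x s)"
      by (intro comp decidable2[OF Q(1)])
    show "\<And>x. P x \<longleftrightarrow> (\<exists>t. \<exists>s\<le>t. Q x s)"
      using Q by auto
  qed (meson le_trans)
qed

text \<open>The empty oracle always answers 0, so its queries can be replaced by
  \<open>ZeroP\<close>. The resulting program behaves in the same way under every oracle.\<close>

primrec strip_oracle :: "oprog \<Rightarrow> oprog" where
  "strip_oracle ZeroP = ZeroP"
| "strip_oracle SuccP = SuccP"
| "strip_oracle FstP = FstP"
| "strip_oracle SndP = SndP"
| "strip_oracle OracleP = ZeroP"
| "strip_oracle (Pairing p q) = Pairing (strip_oracle p) (strip_oracle q)"
| "strip_oracle (Compose p q) = Compose (strip_oracle p) (strip_oracle q)"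
| "strip_oracle (PrimRec p q) = PrimRec (strip_oracle p) (strip_oracle q)"
| "strip_oracle (Minim p) = Minim (strip_oracle p)"

lemma eval_strip_oracle: "eval empty_oracle p n r \<Longrightarrow> eval A (strip_oracle p) n r"
proof (induction rule: eval.induct)
  case (eval_minim y p a)
  then show ?case
    by (auto intro!: eval.eval_minim)
qed (auto simp: empty_oracle_def intro: eval.intros)

lemma computable_in_empty: "f \<le>\<^sub>T empty_oracle \<Longrightarrow> f \<le>\<^sub>T A"
  unfolding computable_in_def using eval_strip_oracle by metis

lemma decidable_in_empty: "decidable_in empty_oracle P \<Longrightarrow> decidable_in A P"
  unfolding decidable_in_def by (rule computable_in_empty)

text \<open>This and the following elimination rule replace sets of prefix codes by conditions on
  the length \<open>k\<close> and the number \<open>rst X k\<close>, which are easier to compute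
  with.\<close>

lemma uniformly_Sigma1I:
  assumes "semidecidable_in A (\<lambda>u. T (pfst u) (pfst (psnd u)) (psnd (psnd u)))"
    and "\<And>m. U m = {X. \<exists>k. T m k (rst X k)}"
  shows "uniformly_Sigma1 A U"
proof -
  define W where "W = {w. \<exists>k (c::nat). psnd w = prefix_code (bit c) k \<and> T (pfst w) k (rst (bit c) k)}"
  have "semidecidable_in A (\<lambda>u. \<exists>c::nat. psnd (pfst u) = prefix_code (bit c) (psnd u) \<and>
      T (pfst (pfst u)) (psnd u) (rst (bit c) (psnd u)))"
  proof (intro semidecidable_ex semidecidable_conj)
    show "semidecidable_in A (\<lambda>u. psnd (pfst (pfst u)) = prefix_code (bit (psnd u)) (psnd (pfst u)))"
      by (intro semidecidable_decidable comp)
    have "(\<lambda>u. prod_encode (pfst (pfst (pfst u)),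
      prod_encode (psnd (pfst u), rst (bit (psnd u)) (psnd (pfst u))))) \<le>\<^sub>T A"
      by (intro comp)
    from semidecidable_compose[OF assms(1) this]
    show "semidecidable_in A (\<lambda>u. T (pfst (pfst (pfst u))) (psnd (pfst u))
        (rst (bit (psnd u)) (psnd (pfst u))))"
      by simp
  qed
  from semidecidable_ex[OF this] have "ce_in A W"
    unfolding ce_in_iff_semidecidable W_def mem_Collect_eq .
  moreover have "U m = {X. \<exists>k. prod_encode (m, prefix_code X k) \<in> W}" for m
  proof -
    have "prod_encode (m, prefix_code X k) \<in> W \<longleftrightarrow> T m k (rst X k)" for X k
    proof
      assume "prod_encode (m, prefix_code X k) \<in> W"
      then show "T m k (rst X k)"
        unfolding W_def by (auto simp: prefix_code_eq_iff)
    next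
      assume "T m k (rst X k)"
      then show "prod_encode (m, prefix_code X k) \<in> W"
        unfolding W_def mem_Collect_eq by - (rule exI[of _ k], rule exI[of _ "rst X k"], simp)
    qed
    then show ?thesis
      using assms(2) by simp
  qed
  ultimately show ?thesis
    unfolding uniformly_Sigma1_def by blast
qed

text \<open>Letting \<open>k\<close> bound both the length of the string and the stage of the
  enumeration makes the condition decidable and monotone. The classes become increasing unions of
  clopen sets whose measures can be counted.\<close>

lemma uniformly_Sigma1E:
  assumes "uniformly_Sigma1 A U"
  obtains T where "decidable3_in A T" "\<And>m. U m = {X. \<exists>k. T m k (rst X k)}"
    "\<And>m X j k. T m j (rst X j) \<Longrightarrow> j \<le> k \<Longrightarrow> T m k (rst X k)"
proof -
  obtain W where W: "ce_in A W" "\<And>m. U m = {X. \<exists>k. prod_encode (m, prefix_code X k) \<in> W}"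
    using assms unfolding uniformly_Sigma1_def by blast
  then obtain Q where Q: "decidable2_in A Q" "\<And>x. x \<in> W \<longleftrightarrow> (\<exists>s. Q x s)"
    unfolding ce_in_iff_semidecidable semidecidable_in_def by auto
  define T where "T m k c \<longleftrightarrow> (\<exists>j\<le>k. \<exists>s\<le>k. Q (prod_encode (m, prefix_code (bit c) j)) s)" for m k and c :: nat
  have T: "T m k (rst X k) \<longleftrightarrow> (\<exists>j\<le>k. \<exists>s\<le>k. Q (prod_encode (m, prefix_code X j)) s)" for m X k
    unfolding T_def by (metis prefix_code_rst)
  show thesis
  proof
    show "decidable3_in A T"
      unfolding T_def by (intro comp decidable2[OF Q(1)])
    show "U m = {X. \<exists>k. T m k (rst X k)}" for m
    proof -
      have "(\<exists>k. T m k (rst X k)) \<longleftrightarrow> (\<exists>j s. Q (prod_encode (m, prefix_code X j)) s)" for X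
        unfolding T by (meson max.cobounded1 max.cobounded2)
      then show ?thesis
        unfolding W(2) Q(2) by auto
    qed
    show "T m j (rst X j) \<Longrightarrow> j \<le> k \<Longrightarrow> T m k (rst X k)" for m X j k
      unfolding T by (meson le_trans)
  qed
qed

lemma Sigma1_class_iff_uniformly_Sigma1: "Sigma1_class A U \<longleftrightarrow> uniformly_Sigma1 A (\<lambda>_. U)"
proof
  assume "Sigma1_class A U"
  then obtain W where W: "ce_in A W" "U = {X. \<exists>k. prefix_code X k \<in> W}"
    unfolding Sigma1_class_def by auto
  have "ce_in A {w. psnd w \<in> W}"
    using semidecidable_compose[OF W(1)[unfolded ce_in_iff_semidecidable] computable_psnd_plain]
    unfolding ce_in_iff_semidecidable by simp
  with W(2) show "uniformly_Sigma1 A (\<lambda>_. U)"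
    unfolding uniformly_Sigma1_def by (intro exI[of _ "{w. psnd w \<in> W}"]) simp
next
  assume "uniformly_Sigma1 A (\<lambda>_. U)"
  then obtain W where W: "ce_in A W" "U = {X. \<exists>k. prod_encode (0, prefix_code X k) \<in> W}"
    unfolding uniformly_Sigma1_def by auto
  have "(\<lambda>w. prod_encode (0, w)) \<le>\<^sub>T A"
    by (intro comp)
  then have "ce_in A {w. prod_encode (0, w) \<in> W}"
    using semidecidable_compose[OF W(1)[unfolded ce_in_iff_semidecidable]]
    unfolding ce_in_iff_semidecidable by simp
  with W(2) show "Sigma1_class A U"
    unfolding Sigma1_class_def by (intro exI[of _ "{w. prod_encode (0, w) \<in> W}"]) simp
qed

lemma Sigma1_classI:
  assumes "semidecidable_in A (\<lambda>u. T (pfst u) (psnd u))" "U = {X. \<exists>k. T k (rst X k)}"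
  shows "Sigma1_class A U"
  unfolding Sigma1_class_iff_uniformly_Sigma1
  using semidecidable_compose[OF assms(1) computable_psnd_plain] assms(2)
  by (intro uniformly_Sigma1I[of _ "\<lambda>_. T"]) auto

lemma Sigma1_classE:
  assumes "Sigma1_class A U"
  obtains T where "decidable2_in A T" "U = {X. \<exists>k. T k (rst X k)}"
    "\<And>X j k. T j (rst X j) \<Longrightarrow> j \<le> k \<Longrightarrow> T k (rst X k)"
proof -
  obtain T where T: "decidable3_in A T" "\<And>m::nat. U = {X. \<exists>k. T m k (rst X k)}"
    "\<And>m X j k. T m j (rst X j) \<Longrightarrow> j \<le> k \<Longrightarrow> T m k (rst X k)"
    by (rule uniformly_Sigma1E[OF assms[unfolded Sigma1_class_iff_uniformly_Sigma1]])
      (rule that; assumption)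
  have "decidable2_in A (T 0)"
    by (intro decidable3[OF T(1)] comp)
  with T(2)[of 0] T(3)[of 0] that show thesis
    by blast
qed

lemma uniformly_Sigma1_section: "uniformly_Sigma1 A U \<Longrightarrow> Sigma1_class A (U m)"
proof (erule uniformly_Sigma1E)
  fix T assume T: "decidable3_in A T" "\<And>m. U m = {X. \<exists>k. T m k (rst X k)}"
  have "decidable2_in A (T m)"
    by (intro decidable3[OF T(1)] comp)
  then show "Sigma1_class A (U m)"
    by (intro Sigma1_classI[of A "T m"] semidecidable_decidable T)
qed

lemma Sigma1_class_Un:
  assumes "Sigma1_class A U" "Sigma1_class A V"
  shows "Sigma1_class A (U \<union> V)"
proof -
  obtain T where T: "decidable2_in A T" "U = {X. \<exists>k. T k (rst X k)}"
    using Sigma1_classE[OF assms(1)] by metis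
  obtain S where S: "decidable2_in A S" "V = {X. \<exists>k. S k (rst X k)}"
    using Sigma1_classE[OF assms(2)] by metis
  have "decidable2_in A (\<lambda>k c. T k c \<or> S k c)"
    by (intro comp S(1) T(1))
  then show ?thesis
    by (intro Sigma1_classI[of A "\<lambda>k c. T k c \<or> S k c"] semidecidable_decidable) (auto simp: T S)
qed

section \<open>The halting set and the arithmetical hierarchy\<close>

definition sigma2 :: "nat set \<Rightarrow> bool" where
  "sigma2 I \<longleftrightarrow> (\<exists>R. decidable3_in empty_oracle R \<and> I = {i. \<exists>a. \<forall>b. R i a b})"

lemma pfst_le: "pfst n \<le> n" and psnd_le: "psnd n \<le> n"
  by (metis le_prod_encode_1 pair_pfst_psnd) (metis le_prod_encode_2 pair_pfst_psnd)

section \<open>The numbering of programs\<close>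

lemma inj_index: "inj index"
proof (rule injI)
  show "index p = index q \<Longrightarrow> p = q" for p q
  proof (induction p arbitrary: q)
    case (Pairing p1 p2)
    then show ?case by (cases q) (auto, presburger+)
  next
    case (Compose p1 p2)
    then show ?case by (cases q) (auto, presburger+)
  next
    case (PrimRec p1 p2)
    then show ?case by (cases q) (auto, presburger+)
  next
    case (Minim p)
    then show ?case by (cases q) (auto, presburger+)
  qed (case_tac q; simp)+
qed

text \<open>From 5 on, the residue modulo 4 fixes the constructor, and the encoded arguments are
  smaller, so strong induction applies. Hence membership in the halting set can be tested without
  first checking that a number is an index.\<close>

lemma surj_index: "\<exists>p. index p = e"
proof (induction e rule: less_induct)
  case (less e)
  consider "e < 5" | m where "e = 5 + 4 * m" | m where "e = 6 + 4 * m" | m where "e = 7 + 4 * m"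
    | m where "e = 8 + 4 * m"
  proof (cases "e < 5")
    case False
    then have "\<exists>m. e = 5 + 4 * m \<or> e = 6 + 4 * m \<or> e = 7 + 4 * m \<or> e = 8 + 4 * m"
      by presburger
    then show thesis
      using that(2-5) by blast
  qed (rule that)
  then show ?case
  proof cases
    case 1
    then have "e \<in> {0, 1, 2, 3, 4}"
      by auto
    then show ?thesis
      by (auto intro: exI[of _ ZeroP] exI[of _ SuccP] exI[of _ FstP] exI[of _ SndP] exI[of _ OracleP])
  next
    case (2 m)
    with less[of "pfst m"] less[of "psnd m"] pfst_le[of m] psnd_le[of m] obtain p q
      where "index p = pfst m" "index q = psnd m" by auto
    with 2 show ?thesis by (intro exI[of _ "Pairing p q"]) simp
  next
    case (3 m)
    with less[of "pfst m"] less[of "psnd m"] pfst_le[of m] psnd_le[of m] obtain p q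
      where "index p = pfst m" "index q = psnd m" by auto
    with 3 show ?thesis by (intro exI[of _ "Compose p q"]) simp
  next
    case (4 m)
    with less[of "pfst m"] less[of "psnd m"] pfst_le[of m] psnd_le[of m] obtain p q
      where "index p = pfst m" "index q = psnd m" by auto
    with 4 show ?thesis by (intro exI[of _ "PrimRec p q"]) simp
  next
    case (5 m)
    with less[of m] obtain p where "index p = m" by auto
    with 5 show ?thesis by (intro exI[of _ "Minim p"]) simp
  qed
qed

primrec const_prog :: "nat \<Rightarrow> oprog" where
  "const_prog 0 = ZeroP"
| "const_prog (Suc c) = Compose SuccP (const_prog c)"

lemma eval_const_prog: "eval A (const_prog c) n r \<longleftrightarrow> r = c"
proof -
  have "eval A (const_prog c) n c"
    by (induction c) (auto intro: eval.intros)
  then show ?thesis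
    using eval_det by blast
qed

lemma computable_index_const_prog: "(\<lambda>c. index (const_prog c)) \<le>\<^sub>T A"
proof -
  have "rec_nat 0 (\<lambda>k s. 6 + 4 * prod_encode (1, s)) c = index (const_prog c)" for c
    by (induction c) auto
  moreover have "(\<lambda>c. rec_nat 0 (\<lambda>k s. 6 + 4 * prod_encode (1, s)) c) \<le>\<^sub>T A"
    by (intro comp)
  ultimately show ?thesis
    by (simp only:)
qed

lemma halting_set_index: "halting_set (index p) \<longleftrightarrow> (\<exists>r. eval empty_oracle p (index p) r)"
  unfolding halting_set_def using inj_index by (auto dest: injD)

text \<open>An instance of the s-m-n theorem: composing \<open>p\<close> with a constant program
  yields a program that ignores its input and runs \<open>p\<close> on \<open>x\<close>. Its index
  is computable from \<open>x\<close>, and running it on its own index asks whether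
  \<open>P x\<close> holds.\<close>

lemma semidecidable_empty_imp_decidable_halting_set:
  assumes "semidecidable_in empty_oracle P"
  shows "decidable_in halting_set P"
proof -
  obtain p where p: "\<And>x. P x \<longleftrightarrow> (\<exists>r. eval empty_oracle p x r)"
    using assms ce_in_iff_semidecidable[of empty_oracle "{x. P x}"] unfolding ce_in_def by auto
  have "halting_set (index (Compose p (const_prog x))) \<longleftrightarrow> P x" for x
  proof -
    have "eval empty_oracle (Compose p (const_prog x)) n r \<longleftrightarrow> eval empty_oracle p x r" for n r
      by (auto elim: eval.cases intro: eval.intros simp: eval_const_prog)
    then show ?thesis
      unfolding halting_set_index p by blast
  qed
  \<comment> \<open>The number displayed is the index of the composition, unfolded so that the
    computability rules apply.\<close>
  moreover have "decidable_in halting_set (\<lambda>x. halting_set (6 + 4 * prod_encode (index p, index (const_prog x))))"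
    by (intro comp computable_compose[OF computable_index_const_prog])
  ultimately show ?thesis
    by simp
qed

section \<open>Post's theorem for the second level\<close>

lemma sigma2_imp_ce_in_halting_set:
  assumes "sigma2 I"
  shows "ce_in halting_set I"
proof -
  obtain R where R: "decidable3_in empty_oracle R" "I = {i. \<exists>a. \<forall>b. R i a b}"
    using assms unfolding sigma2_def by auto
  have "semidecidable_in empty_oracle (\<lambda>u. \<exists>b. \<not> R (pfst u) (psnd u) b)"
    by (intro semidecidable_ex semidecidable_decidable comp decidable3[OF R(1)])
  from decidable_not[OF semidecidable_empty_imp_decidable_halting_set[OF this]]
  have "semidecidable_in halting_set (\<lambda>i. \<exists>a. \<forall>b. R i a b)"
    by (intro semidecidable_ex semidecidable_decidable) simp
  then show ?thesis
    unfolding ce_in_iff_semidecidable R(2) by simp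
qed

lemma ce_in_halting_set_imp_sigma2:
  assumes "ce_in halting_set I"
  shows "sigma2 I"
proof -
  obtain p where p: "I = {n. \<exists>r. eval halting_set p n r}"
    using assms unfolding ce_in_def by auto
  define H where "H e s \<longleftrightarrow> halts_by empty_oracle e e s" for e s
  have dH: "decidable2_in empty_oracle H"
    unfolding H_def by (intro comp)
  have H: "halting_set e \<longleftrightarrow> (\<exists>s. H e s)" for e
    unfolding H_def using surj_index[of e] eval_halts_by halts_by_eval halting_set_index by metis
  \<comment> \<open>The witness \<open>a\<close> encodes \<open>((s, c), t)\<close>: a halting stage
    \<open>s\<close>, a guess \<open>c\<close> at the first \<open>s\<close> answers of the halting
    set, and a time \<open>t\<close> confirming the positive ones. The number \<open>b\<close>
    ranges over the stages that could refute a negative answer.\<close>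
  define R where "R x a b \<longleftrightarrow> halts_by (bit (psnd (pfst a))) (index p) x (pfst (pfst a)) \<and>
      (\<forall>i<pfst (pfst a). (bit (psnd (pfst a)) i \<longrightarrow> (\<exists>u\<le>psnd a. H i u)) \<and>
        (\<not> bit (psnd (pfst a)) i \<longrightarrow> \<not> H i b))" for x a b
  have "decidable3_in empty_oracle R"
    unfolding R_def by (intro comp decidable2[OF dH])
  moreover have "x \<in> I \<longleftrightarrow> (\<exists>a. \<forall>b. R x a b)" for x
  proof
    assume "x \<in> I"
    then obtain r where "eval halting_set p x r"
      using p by auto
    then obtain s where s: "halts_by halting_set (index p) x s"
      by (rule eval_halts_by[THEN exE])
    have "\<forall>i. \<exists>t. halting_set i \<longrightarrow> H i t"
      unfolding H by blast
    then obtain t where t: "\<And>i. halting_set i \<Longrightarrow> H i (t i)"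
      by metis
    have "t i \<le> (\<Sum>i<s. t i)" if "i < s" for i
      using that by (intro member_le_sum) auto
    with s t have "\<forall>b. R x (prod_encode (prod_encode (s, rst halting_set s), \<Sum>i<s. t i)) b"
      unfolding R_def using H by auto
    then show "\<exists>a. \<forall>b. R x a b" ..
  next
    assume "\<exists>a. \<forall>b. R x a b"
    then obtain a where a: "\<And>b. R x a b" by auto
    have "bit (psnd (pfst a)) i = halting_set i" if "i < pfst (pfst a)" for i
      using a that unfolding R_def H by blast
    then have "halts_by halting_set (index p) x (pfst (pfst a))"
      using a halts_by_cong[of "pfst (pfst a)" "bit (psnd (pfst a))" halting_set]
      unfolding R_def by blast
    then show "x \<in> I"
      unfolding p using halts_by_eval by blast
  qed
  ultimately show ?thesis
    unfolding sigma2_def by blast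
qed

section \<open>The coin-tossing measure\<close>

abbreviation coin_prob :: "cantor set \<Rightarrow> real" ("\<mu>") where
  "\<mu> \<equiv> measure coin_measure"

interpretation coin_factor: product_prob_space "\<lambda>_. measure_pmf (bernoulli_pmf (1/2))" "UNIV :: nat set"
  by standard

interpretation coin: prob_space coin_measure
  unfolding coin_measure_def by (rule coin_factor.P.prob_space_axioms)

lemma space_coin_measure [simp]: "space coin_measure = UNIV"
  by (simp add: coin_measure_def space_PiM)

lemma prob_cylinder:
  assumes "finite J"
  shows "{X. \<forall>i\<in>J. X i = b i} \<in> sets coin_measure" "\<mu> {X. \<forall>i\<in>J. X i = b i} = (1/2) ^ card J"
proof -
  have [measurable]: "(\<lambda>X. X i) \<in> coin_measure \<rightarrow>\<^sub>M count_space UNIV" for i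
    unfolding coin_measure_def by simp
  have "{X \<in> space coin_measure. \<forall>i\<in>J. X i = b i} \<in> sets coin_measure"
    using assms by measurable
  then show "{X. \<forall>i\<in>J. X i = b i} \<in> sets coin_measure"
    by simp
  have "emeasure coin_measure {X. \<forall>i\<in>J. X i = b i} =
      emeasure coin_measure {X \<in> space (PiM UNIV (\<lambda>_::nat. measure_pmf (bernoulli_pmf (1/2)))). \<forall>i\<in>J. X i \<in> {b i}}"
    by (simp add: space_PiM)
  also have "\<dots> = (\<Prod>i\<in>J. emeasure (measure_pmf (bernoulli_pmf (1/2))) {b i})"
    unfolding coin_measure_def using assms by (intro coin_factor.emeasure_PiM_Collect) auto
  also have "emeasure (measure_pmf (bernoulli_pmf (1/2))) {x} = ennreal (1/2)" for x
    by (cases x) (simp_all add: emeasure_pmf_single)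
  then have "(\<Prod>i\<in>J. emeasure (measure_pmf (bernoulli_pmf (1/2))) {b i}) = ennreal ((1/2) ^ card J)"
    by (simp only: prod_constant) (subst ennreal_power, simp_all)
  finally show "\<mu> {X. \<forall>i\<in>J. X i = b i} = (1/2) ^ card J"
    by (simp add: measure_def)
qed

lemma prob_rst_eq:
  assumes "c < 2 ^ k"
  shows "{X. rst X k = c} \<in> sets coin_measure" "\<mu> {X. rst X k = c} = (1/2) ^ k"
proof -
  have "rst X k = c \<longleftrightarrow> (\<forall>i\<in>{..<k}. X i = bit c i)" for X
    using rst_eq_iff[of X k "bit c"] assms by auto
  then have "{X. rst X k = c} = {X. \<forall>i\<in>{..<k}. X i = bit c i}"
    by blast
  then show "{X. rst X k = c} \<in> sets coin_measure" "\<mu> {X. rst X k = c} = (1/2) ^ k"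
    using prob_cylinder[of "{..<k}" "bit c"] by simp_all
qed

lemma rst_Collect_eq: "{X. S (rst X k)} = (\<Union>c\<in>{c. c < 2 ^ k \<and> S c}. {X. rst X k = c})"
  by auto

lemma sets_rst [measurable, simp]: "{X. S (rst X k)} \<in> sets coin_measure"
  unfolding rst_Collect_eq[of S] by (intro sets.finite_UN) (auto intro: prob_rst_eq)

lemma prob_rst: "\<mu> {X. S (rst X k)} = card {c. c < 2 ^ k \<and> S c} / 2 ^ k"
proof -
  have "\<mu> (\<Union>c\<in>{c. c < 2 ^ k \<and> S c}. {X. rst X k = c}) =
      (\<Sum>c\<in>{c. c < 2 ^ k \<and> S c}. \<mu> {X. rst X k = c})"
    by (intro coin.finite_measure_finite_Union) (auto simp: disjoint_family_on_def prob_rst_eq)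
  also have "\<dots> = (\<Sum>c\<in>{c. c < 2 ^ k \<and> S c}. (1/2) ^ k)"
    by (intro sum.cong) (auto simp: prob_rst_eq)
  finally show ?thesis
    unfolding rst_Collect_eq[of S] by (simp add: power_one_over field_simps)
qed

lemma sets_ex_rst [measurable, simp]: "{X. \<exists>k. T k (rst X k)} \<in> sets coin_measure"
proof -
  have "{X. \<exists>k. T k (rst X k)} = (\<Union>k. {X. T k (rst X k)})"
    by auto
  then show ?thesis
    by simp
qed

lemma sets_Sigma1_class: "Sigma1_class A U \<Longrightarrow> U \<in> sets coin_measure"
  by (erule Sigma1_classE) simp

lemma sets_uniformly_Sigma1: "uniformly_Sigma1 A U \<Longrightarrow> U m \<in> sets coin_measure"
  by (blast intro: sets_Sigma1_class uniformly_Sigma1_section)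

lemma sets_Pi1_class: "Pi1_class A Q \<Longrightarrow> Q \<in> sets coin_measure"
  unfolding Pi1_class_def using sets_Sigma1_class[of A "- Q"] sets.compl_sets[of "- Q" coin_measure]
  by (simp add: Compl_eq_Diff_UNIV[symmetric])

lemma LIMSEQ_prob_incr:
  assumes "\<And>X j k. T j (rst X j) \<Longrightarrow> j \<le> k \<Longrightarrow> T k (rst X k)"
  shows "(\<lambda>k. \<mu> {X. T k (rst X k)}) \<longlonglongrightarrow> \<mu> {X. \<exists>k. T k (rst X k)}"
proof -
  have "incseq (\<lambda>k. {X. T k (rst X k)})"
    using assms by (auto simp: incseq_def)
  from coin.finite_Lim_measure_incseq[OF _ this] show ?thesis
    by (simp add: image_subset_iff Collect_ex_eq)
qed

lemma LIMSEQ_prob_decr: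
  assumes "\<And>X j k. T k (rst X k) \<Longrightarrow> j \<le> k \<Longrightarrow> T j (rst X j)"
  shows "(\<lambda>k. \<mu> {X. T k (rst X k)}) \<longlonglongrightarrow> \<mu> {X. \<forall>k. T k (rst X k)}"
proof -
  have "decseq (\<lambda>k. {X. T k (rst X k)})"
    using assms by (auto simp: decseq_def)
  from coin.finite_Lim_measure_decseq[OF _ this] show ?thesis
    by (simp add: image_subset_iff Collect_all_eq)
qed

section \<open>Independent clopen sets of prescribed measure\<close>

text \<open>The blocks are disjoint because they lie in different rows of the pairing function; this
  is the source of independence for the sets \<open>clo i\<close>.\<close>

definition block :: "nat \<Rightarrow> nat set" where
  "block i = (\<lambda>j. prod_encode (i, j)) ` {..pfst i}"

definition clo :: "nat \<Rightarrow> cantor set" where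
  "clo i = {X. \<forall>n\<in>block i. X n}"

lemma finite_block [simp]: "finite (block i)"
  by (simp add: block_def)

lemma card_block: "card (block i) = Suc (pfst i)"
  unfolding block_def by (subst card_image) (auto simp: inj_on_def)

lemma block_disjoint: "i \<noteq> j \<Longrightarrow> block i \<inter> block j = {}"
  by (auto simp: block_def)

lemma prob_INT_clo:
  assumes "finite L"
  shows "(\<Inter>i\<in>L. clo i) \<in> sets coin_measure" "\<mu> (\<Inter>i\<in>L. clo i) = (\<Prod>i\<in>L. (1/2) ^ Suc (pfst i))"
proof -
  have eq: "(\<Inter>i\<in>L. clo i) = {X. \<forall>n\<in>(\<Union>i\<in>L. block i). X n = True}"
    by (auto simp: clo_def)
  have fin: "finite (\<Union>i\<in>L. block i)"
    using assms by simp
  show "(\<Inter>i\<in>L. clo i) \<in> sets coin_measure"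
    unfolding eq by (rule prob_cylinder[OF fin])
  have "card (\<Union>i\<in>L. block i) = (\<Sum>i\<in>L. Suc (pfst i))"
    using assms by (subst card_UN_disjoint) (auto simp: block_disjoint card_block)
  then show "\<mu> (\<Inter>i\<in>L. clo i) = (\<Prod>i\<in>L. (1/2) ^ Suc (pfst i))"
    unfolding eq prob_cylinder(2)[OF fin] by (simp only: power_sum)
qed

lemma sets_clo [measurable, simp]: "clo i \<in> sets coin_measure"
  and prob_clo: "\<mu> (clo i) = (1/2) ^ Suc (pfst i)"
  using prob_INT_clo[of "{i}"] by simp_all

text \<open>Avoiding one further set is a difference of two events, in the second of which that set
  has moved from \<open>J\<close> to \<open>L\<close>. This is why the induction on \<open>J\<close>
  needs arbitrary \<open>L\<close>.\<close>

lemma prob_clo_indep: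
  assumes "finite J" "finite L" "J \<inter> L = {}"
  shows "\<mu> ((\<Inter>i\<in>L. clo i) \<inter> (\<Inter>i\<in>J. - clo i)) =
    (\<Prod>i\<in>L. (1/2) ^ Suc (pfst i)) * (\<Prod>i\<in>J. 1 - (1/2) ^ Suc (pfst i))"
  using assms
proof (induction J arbitrary: L rule: finite_induct)
  case empty
  then show ?case
    by (simp add: prob_INT_clo)
next
  case (insert j J)
  let ?E = "\<lambda>L. (\<Inter>i\<in>L. clo i) \<inter> (\<Inter>i\<in>J. - clo i)"
  have meas: "?E L \<in> sets coin_measure" if "finite L" for L
  proof -
    have "(\<Inter>i\<in>J. - clo i) = space coin_measure - (\<Union>i\<in>J. clo i)"
      by auto
    also have "\<dots> \<in> sets coin_measure"
      using insert.hyps by (intro sets.compl_sets sets.finite_UN) auto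
    finally show ?thesis
      using prob_INT_clo(1)[OF that] by blast
  qed
  have "(\<Inter>i\<in>L. clo i) \<inter> (\<Inter>i\<in>insert j J. - clo i) = ?E L - ?E (insert j L)"
    by auto
  also have "\<mu> \<dots> = \<mu> (?E L) - \<mu> (?E (insert j L))"
    using insert.prems by (intro coin.finite_measure_Diff meas) auto
  also have "\<dots> = (\<Prod>i\<in>L. (1/2) ^ Suc (pfst i)) * (\<Prod>i\<in>J. 1 - (1/2) ^ Suc (pfst i))
      - (\<Prod>i\<in>insert j L. (1/2) ^ Suc (pfst i)) * (\<Prod>i\<in>J. 1 - (1/2) ^ Suc (pfst i))"
    using insert by (subst (1 2) insert.IH) auto
  also have "\<dots> = (\<Prod>i\<in>L. (1/2) ^ Suc (pfst i)) * (\<Prod>i\<in>insert j J. 1 - (1/2) ^ Suc (pfst i))"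
    using insert by (simp add: algebra_simps)
  finally show ?case .
qed

text \<open>The quantitative form of the second Borel-Cantelli lemma, from independence and 1 - x
  \<le> exp (-x).\<close>

lemma prob_avoid_clo_le:
  assumes "finite J"
  shows "\<mu> (\<Inter>i\<in>J. - clo i) \<le> exp (- (\<Sum>i\<in>J. (1/2) ^ Suc (pfst i)))"
proof -
  have "\<mu> (\<Inter>i\<in>J. - clo i) = (\<Prod>i\<in>J. 1 - (1/2) ^ Suc (pfst i))"
    using prob_clo_indep[OF assms, of "{}"] by simp
  also have "\<dots> \<le> (\<Prod>i\<in>J. exp (- ((1/2) ^ Suc (pfst i))))"
  proof (intro prod_mono conjI)
    fix i
    show "(0::real) \<le> 1 - (1/2) ^ Suc (pfst i)"
      using power_le_one[of "1/2 :: real" "Suc (pfst i)"] by simp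
    show "1 - (1/2) ^ Suc (pfst i) \<le> exp (- ((1/2::real) ^ Suc (pfst i)))"
      using exp_ge_add_one_self[of "- ((1/2::real) ^ Suc (pfst i))"] by simp
  qed
  also have "\<dots> = exp (- (\<Sum>i\<in>J. (1/2) ^ Suc (pfst i)))"
    using assms by (simp add: exp_sum[symmetric] sum_negf)
  finally show ?thesis .
qed

section \<open>Weights and the extraction of covers\<close>

definition finite_weight :: "nat set \<Rightarrow> bool" where
  "finite_weight I \<longleftrightarrow> summable (\<lambda>i. of_bool (i \<in> I) * (1/2 :: real) ^ pfst i)"

lemma finite_weightI:
  assumes "\<And>F. finite F \<Longrightarrow> F \<subseteq> I \<Longrightarrow> (\<Sum>i\<in>F. (1/2 :: real) ^ pfst i) \<le> c"
  shows "finite_weight I"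
  unfolding finite_weight_def
proof (rule summableI_nonneg_bounded)
  fix N
  have "(\<Sum>i<N. of_bool (i \<in> I) * (1/2 :: real) ^ pfst i) = (\<Sum>i\<in>{..<N} \<inter> I. (1/2) ^ pfst i)"
    unfolding sum.inter_restrict[OF finite_lessThan] by (rule sum.cong) auto
  also have "\<dots> \<le> c"
    by (intro assms) auto
  finally show "(\<Sum>i<N. of_bool (i \<in> I) * (1/2 :: real) ^ pfst i) \<le> c" .
qed simp

text \<open>The cover consists of all \<open>i\<close> for which \<open>clo i\<close> meets
  \<open>Q\<close> in very small measure, which is eventually recognised from the approximations of
  \<open>Q\<close>. Most of \<open>Q\<close> avoids all these \<open>clo i\<close>; since they are
  independent, infinite weight would make such avoidance a null event.\<close>

lemma null_clo_imp_finite_weight_cover: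
  assumes Q: "Pi1_class B Q" "0 < \<mu> Q"
    and null: "\<And>i. i \<in> I \<Longrightarrow> n \<le> i \<Longrightarrow> \<mu> (Q \<inter> clo i) = 0"
  obtains J where "ce_in B J" "I \<subseteq> J" "finite_weight J"
proof -
  obtain T where T: "decidable2_in B T" "- Q = {X. \<exists>k. T k (rst X k)}"
    "\<And>X j k. T j (rst X j) \<Longrightarrow> j \<le> k \<Longrightarrow> T k (rst X k)"
    by (rule Sigma1_classE[OF Q(1)[unfolded Pi1_class_def]]) (rule that; assumption)
  \<comment> \<open>The strings of length \<open>k\<close> that still look compatible with both
    \<open>Q\<close> and \<open>clo i\<close>. Bits beyond \<open>k\<close> are unconstrained, so
    these clopen sets decrease to the intersection.\<close>
  define S where "S i k c \<longleftrightarrow> \<not> T k c \<and>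
      (\<forall>j\<le>pfst i. prod_encode (i, j) < k \<longrightarrow> bit c (prod_encode (i, j)))" for i k c :: nat
  have S_lim: "(\<lambda>k. \<mu> {X. S i k (rst X k)}) \<longlonglongrightarrow> \<mu> (Q \<inter> clo i)" for i
  proof -
    have "(\<lambda>k. \<mu> {X. S i k (rst X k)}) \<longlonglongrightarrow> \<mu> {X. \<forall>k. S i k (rst X k)}"
      by (rule LIMSEQ_prob_decr) (use T(3) in \<open>auto simp: S_def\<close>)
    moreover have "{X. \<forall>k. S i k (rst X k)} = Q \<inter> clo i"
    proof -
      have "X \<in> Q \<longleftrightarrow> (\<forall>k. \<not> T k (rst X k))" for X
        using T(2) by blast
      moreover have "X \<in> clo i \<longleftrightarrow> (\<forall>k. \<forall>j\<le>pfst i. prod_encode (i, j) < k \<longrightarrow> X (prod_encode (i, j)))" for X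
        unfolding clo_def block_def by auto
      ultimately show ?thesis
        unfolding S_def by auto
    qed
    ultimately show ?thesis
      by simp
  qed
  have S_ge: "\<mu> (Q \<inter> clo i) \<le> \<mu> {X. S i k (rst X k)}" for i k
    using T(2) by (intro coin.finite_measure_mono[OF _ sets_rst]) (auto simp: S_def clo_def block_def)
  obtain a where a: "(1/2 :: real) ^ a < \<mu> Q / 4"
    using real_arch_pow_inv[of "\<mu> Q / 4" "1/2"] Q(2) by auto
  \<comment> \<open>\<open>2\<^sup>-\<^sup>i\<^sup>-\<^sup>a\<close> is so small that removing every \<open>clo i\<close> with \<open>i \<in> J\<close>, \<open>i \<ge> n\<close> leaves half of \<open>Q\<close>\<close>
  define J where "J = {i. i < n \<or> (\<exists>k. card {c. c < 2 ^ k \<and> S i k c} * 2 ^ (i + a) < 2 ^ k)}"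
  have J_iff: "i \<in> J \<longleftrightarrow> i < n \<or> (\<exists>k. \<mu> {X. S i k (rst X k)} < (1/2) ^ (i + a))" for i
  proof -
    have "card {c. c < 2 ^ k \<and> S i k c} * 2 ^ (i + a) < 2 ^ k \<longleftrightarrow>
        \<mu> {X. S i k (rst X k)} < (1/2) ^ (i + a)" for k
    proof -
      have "card {c. c < 2 ^ k \<and> S i k c} * 2 ^ (i + a) < 2 ^ k \<longleftrightarrow>
        real (card {c. c < 2 ^ k \<and> S i k c} * 2 ^ (i + a)) < real (2 ^ k)"
        by (simp only: of_nat_less_iff)
      then show ?thesis
        unfolding prob_rst by (simp add: power_one_over field_simps)
    qed
    then show ?thesis
      unfolding J_def by simp
  qed
  have "semidecidable_in B (\<lambda>i. i < n \<or> (\<exists>k. card {c. c < 2 ^ k \<and> S i k c} * 2 ^ (i + a) < 2 ^ k))"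
    unfolding S_def
    by (intro semidecidable_disj semidecidable_ex semidecidable_decidable comp decidable2[OF T(1)])
  then have ce: "ce_in B J"
    unfolding ce_in_iff_semidecidable J_def by simp
  have sub: "I \<subseteq> J"
  proof
    fix i assume "i \<in> I"
    show "i \<in> J"
    proof (cases "n \<le> i")
      case True
      with \<open>i \<in> I\<close> null S_lim[of i] have "(\<lambda>k. \<mu> {X. S i k (rst X k)}) \<longlonglongrightarrow> 0"
        by simp
      from order_tendstoD(2)[OF this, of "(1/2) ^ (i + a)"]
      obtain k where "\<mu> {X. S i k (rst X k)} < (1/2) ^ (i + a)"
        by (auto simp: eventually_sequentially)
      then show ?thesis
        unfolding J_iff by blast
    qed (simp add: J_def)
  qed
  \<comment> \<open>The indices below \<open>n\<close> weigh at most 1 each. For the others, half of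
    the measure of \<open>Q\<close> is at most \<open>exp\<close> of minus half their weight, and
    taking logarithms gives the second summand.\<close>
  have "(\<Sum>i\<in>F. (1/2 :: real) ^ pfst i) \<le> real n + 2 * ln (2 / \<mu> Q)" if "finite F" "F \<subseteq> J" for F
  proof -
    define G where "G = F - {..<n}"
    have G: "finite G" "\<And>i. i \<in> G \<Longrightarrow> \<mu> (Q \<inter> clo i) \<le> (1/2) ^ (i + a)"
      using that J_iff S_ge by (auto simp: G_def) (meson in_mono linorder_not_less order.strict_iff_not order_trans)
    have geo: "(\<Sum>i\<in>G. (1/2 :: real) ^ i) \<le> 2"
    proof -
      have "(\<Sum>i\<in>G. (1/2 :: real) ^ i) \<le> (\<Sum>i. (1/2) ^ i)"
        using G by (intro sum_le_suminf summable_geometric) auto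
      then show ?thesis
        by (simp add: suminf_geometric)
    qed
    have sets: "(\<Inter>i\<in>G. - clo i) \<in> sets coin_measure"
    proof -
      have "(\<Inter>i\<in>G. - clo i) = space coin_measure - (\<Union>i\<in>G. clo i)"
        by auto
      also have "\<dots> \<in> sets coin_measure"
        using G by (intro sets.compl_sets sets.finite_UN) auto
      finally show ?thesis .
    qed
    have Qs: "Q \<in> sets coin_measure"
      by (rule sets_Pi1_class[OF Q(1)])
    have "\<mu> Q \<le> \<mu> ((\<Union>i\<in>G. Q \<inter> clo i) \<union> (\<Inter>i\<in>G. - clo i))"
      using sets Qs G by (intro coin.finite_measure_mono) auto
    also have "\<dots> \<le> \<mu> (\<Union>i\<in>G. Q \<inter> clo i) + \<mu> (\<Inter>i\<in>G. - clo i)"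
      using sets Qs G by (intro measure_Un_le) auto
    also have "\<mu> (\<Union>i\<in>G. Q \<inter> clo i) \<le> (\<Sum>i\<in>G. \<mu> (Q \<inter> clo i))"
      using Qs G by (intro measure_UNION_le) auto
    also have "\<dots> \<le> (\<Sum>i\<in>G. (1/2) ^ (i + a))"
      by (intro sum_mono G)
    also have "\<dots> = (1/2) ^ a * (\<Sum>i\<in>G. (1/2) ^ i)"
      by (simp add: power_add sum_distrib_left mult.commute)
    also have "\<dots> \<le> \<mu> Q / 4 * 2"
      using a geo Q by (intro mult_mono) (auto intro: sum_nonneg)
    also have "\<mu> (\<Inter>i\<in>G. - clo i) \<le> exp (- (\<Sum>i\<in>G. (1/2) ^ Suc (pfst i)))"
      by (rule prob_avoid_clo_le[OF G(1)])
    finally have "\<mu> Q / 2 \<le> exp (- (\<Sum>i\<in>G. (1/2) ^ Suc (pfst i)))"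
      by simp
    then have "ln (\<mu> Q / 2) \<le> ln (exp (- (\<Sum>i\<in>G. (1/2) ^ Suc (pfst i))))"
      using Q(2) by (subst ln_le_cancel_iff) auto
    then have "ln (\<mu> Q / 2) \<le> - (\<Sum>i\<in>G. (1/2) ^ Suc (pfst i))"
      by (simp only: ln_exp)
    then have 1: "(\<Sum>i\<in>G. (1/2) ^ pfst i) \<le> 2 * ln (2 / \<mu> Q)"
      using Q(2) by (simp add: ln_div sum_divide_distrib[symmetric])
    have "(\<Sum>i\<in>F. (1/2 :: real) ^ pfst i) \<le> (\<Sum>i\<in>G \<union> {..<n}. (1/2) ^ pfst i)"
      using that by (intro sum_mono2) (auto simp: G_def)
    also have "\<dots> \<le> (\<Sum>i\<in>G. (1/2) ^ pfst i) + (\<Sum>i\<in>{..<n}. (1/2) ^ pfst i)"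
      using G by (subst sum.union_disjoint) (auto simp: G_def)
    also have "(\<Sum>i\<in>{..<n}. (1/2 :: real) ^ pfst i) \<le> (\<Sum>i\<in>{..<n}. 1)"
      by (intro sum_mono power_le_one) auto
    finally show ?thesis
      using 1 by simp
  qed
  then have "finite_weight J"
    by (rule finite_weightI)
  with ce sub show thesis
    by (rule that)
qed

section \<open>Solovay tests\<close>

text \<open>Being in at least \<open>c * 2 ^ n\<close> of the sets \<open>D i\<close> is effectively
  open. With \<open>c\<close> a bound on the sum of their measures, Markov's inequality for the
  counting function gives measure at most 2^-n, so these events form a Martin-Loef test.\<close>

lemma solovay_test:
  assumes D: "uniformly_Sigma1 A D" and sum: "summable (\<lambda>i. \<mu> (D i))"
    and inf: "infinite {i. X \<in> D i}"
  shows "\<not> random_in A X"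
proof -
  obtain T where T: "decidable3_in A T" "\<And>m. D m = {X. \<exists>k. T m k (rst X k)}"
    "\<And>m X j k. T m j (rst X j) \<Longrightarrow> j \<le> k \<Longrightarrow> T m k (rst X k)"
    by (rule uniformly_Sigma1E[OF D]) (rule that; assumption)
  obtain c :: nat where c: "(\<Sum>i. \<mu> (D i)) \<le> real c" "0 < c"
  proof -
    obtain n where "(\<Sum>i. \<mu> (D i)) \<le> real n"
      using real_arch_simple by blast
    then show thesis
      by (intro that[of "Suc n"]) auto
  qed
  define H where "H n k r \<longleftrightarrow> c * 2 ^ n \<le> card {i. i < k \<and> T i k r}" for n k r :: nat
  define G where "G n = {X. \<exists>k. H n k (rst X k)}" for n
  have "decidable3_in A H"
    unfolding H_def by (intro comp decidable3[OF T(1)])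
  then have "uniformly_Sigma1 A G"
    by (intro uniformly_Sigma1I[of A H] semidecidable_decidable) (simp_all add: G_def)
  moreover have "decseq G"
  proof (unfold decseq_def, intro allI impI)
    fix m n :: nat assume "m \<le> n"
    then have "c * 2 ^ m \<le> c * 2 ^ n"
      by simp
    then show "G n \<subseteq> G m"
      unfolding G_def H_def by (blast intro: le_trans)
  qed
  moreover have "\<mu> (G n) \<le> (1/2) ^ n" for n
  proof -
    have "(\<lambda>k. \<mu> {X. H n k (rst X k)}) \<longlonglongrightarrow> \<mu> (G n)"
      unfolding G_def
    proof (rule LIMSEQ_prob_incr)
      fix X and j k :: nat assume jk: "H n j (rst X j)" "j \<le> k"
      then have "{i. i < j \<and> T i j (rst X j)} \<subseteq> {i. i < k \<and> T i k (rst X k)}"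
        using T(3) by auto
      then have "card {i. i < j \<and> T i j (rst X j)} \<le> card {i. i < k \<and> T i k (rst X k)}"
        by (intro card_mono) auto
      with jk show "H n k (rst X k)"
        unfolding H_def by linarith
    qed
    moreover have "\<mu> {X. H n k (rst X k)} \<le> (1/2) ^ n" for k
    proof -
      let ?u = "\<lambda>X. \<Sum>i<k. indicator {X. T i k (rst X k)} X :: real"
      have card: "real (card {i. i < k \<and> T i k (rst X k)}) = ?u X" for X
        by (simp add: indicator_def sum.If_cases Int_def lessThan_def)
      have int: "integrable coin_measure ?u"
        by (intro Bochner_Integration.integrable_sum) (simp add: coin.emeasure_eq_measure)
      have "(\<integral>X. ?u X \<partial>coin_measure) = (\<Sum>i<k. \<mu> {X. T i k (rst X k)})"
        by (subst Bochner_Integration.integral_sum) (simp_all add: coin.emeasure_eq_measure)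
      also have "\<dots> \<le> (\<Sum>i<k. \<mu> (D i))"
        unfolding T(2) by (intro sum_mono coin.finite_measure_mono) auto
      also have "\<dots> \<le> c"
        using sum_le_suminf[OF sum, of "{..<k}"] c by simp
      finally have 1: "(\<integral>X. ?u X \<partial>coin_measure) \<le> c" .
      have "\<mu> {X \<in> space coin_measure. ?u X \<ge> c * 2 ^ n} \<le> (\<integral>X. ?u X \<partial>coin_measure) / (c * 2 ^ n)"
        using c by (intro integral_Markov_inequality_measure[OF int, of "{}"]) (auto intro: sum_nonneg)
      also have "\<dots> \<le> c / (c * 2 ^ n)"
        using 1 c by (intro divide_right_mono) auto
      also have "\<dots> = (1/2) ^ n"
        using c by (simp add: power_one_over field_simps)
      also have "{X \<in> space coin_measure. ?u X \<ge> c * 2 ^ n} = {X. H n k (rst X k)}"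
        unfolding H_def card[symmetric]
        by (simp flip: of_nat_le_iff[where ?'a = real])
      finally show ?thesis .
    qed
    ultimately show ?thesis
      by (intro LIMSEQ_le_const2[of _ "\<mu> (G n)"]) auto
  qed
  ultimately have "martin_loef_test A G"
    unfolding martin_loef_test_def by simp
  moreover have "X \<in> G n" for n
  proof -
    obtain F where F: "finite F" "card F = c * 2 ^ n" "F \<subseteq> {i. X \<in> D i}"
      using infinite_arbitrarily_large[OF inf] by blast
    then have "\<forall>i. \<exists>k. i \<in> F \<longrightarrow> T i k (rst X k)"
      using T(2) by blast
    then obtain k where k: "\<And>i. i \<in> F \<Longrightarrow> T i (k i) (rst X (k i))"
      by metis
    define m where "m = Suc (\<Sum>i\<in>F. i + k i)"
    have m: "i < m \<and> k i \<le> m" if "i \<in> F" for i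
      using member_le_sum[of i F "\<lambda>i. i + k i"] F(1) that by (auto simp: m_def)
    then have "F \<subseteq> {i. i < m \<and> T i m (rst X m)}"
      using k T(3) by blast
    then have "card F \<le> card {i. i < m \<and> T i m (rst X m)}"
      by (intro card_mono) auto
    then show ?thesis
      unfolding G_def H_def using F(2) by auto
  qed
  ultimately show ?thesis
    unfolding random_in_def by blast
qed

section \<open>Covering sets of finite weight\<close>

lemma countable_oprog: "countable (UNIV :: oprog set)"
  using inj_index by (rule countableI)

lemma countable_computable_in: "countable {f. f \<le>\<^sub>T A}"
proof (rule countable_subset)
  show "{f. f \<le>\<^sub>T A} \<subseteq> range (\<lambda>p n. THE r. eval A p n r)"
  proof
    fix f assume "f \<in> {f. f \<le>\<^sub>T A}"
    then obtain p where "\<And>n. eval A p n (f n)"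
      unfolding computable_in_def by auto
    then have "f = (\<lambda>n. THE r. eval A p n r)"
      using eval_det by (intro ext the_equality[symmetric]) blast+
    then show "f \<in> range (\<lambda>p n. THE r. eval A p n r)"
      by blast
  qed
qed (simp add: countable_oprog)

lemma countable_martin_loef_test: "countable {U. martin_loef_test A U}"
proof (rule countable_subset)
  show "{U. martin_loef_test A U} \<subseteq>
      range (\<lambda>p m. {X. \<exists>k. prod_encode (m, prefix_code X k) \<in> {n. \<exists>r. eval A p n r}})"
  proof
    fix U assume "U \<in> {U. martin_loef_test A U}"
    then obtain p where "\<And>m. U m = {X. \<exists>k. prod_encode (m, prefix_code X k) \<in> {n. \<exists>r. eval A p n r}}"
      unfolding martin_loef_test_def uniformly_Sigma1_def ce_in_def by auto
    then show "U \<in> range (\<lambda>p m. {X. \<exists>k. prod_encode (m, prefix_code X k) \<in> {n. \<exists>r. eval A p n r}})"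
      by blast
  qed
qed (simp add: countable_oprog)

section \<open>The covering property, positive measure domination and LR-reducibility\<close>

definition covers_sigma2 :: "cantor \<Rightarrow> bool" where
  "covers_sigma2 B \<longleftrightarrow>
    (\<forall>I. sigma2 I \<and> finite_weight I \<longrightarrow> (\<exists>J. ce_in B J \<and> I \<subseteq> J \<and> finite_weight J))"

lemma Sigma1_class_Compl_clo: "Sigma1_class A (- clo i)"
proof (rule Sigma1_classI)
  show "semidecidable_in A (\<lambda>u. \<exists>j\<le>pfst i. prod_encode (i, j) < pfst u \<and>
      \<not> bit (psnd u) (prod_encode (i, j)))"
    by (intro semidecidable_decidable comp)
qed (auto simp: clo_def block_def)

lemma positive_measure_dominating_imp_covers_sigma2:
  assumes "positive_measure_dominating B"
  shows "covers_sigma2 B"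
  unfolding covers_sigma2_def
proof (intro allI impI)
  fix I assume I: "sigma2 I \<and> finite_weight I"
  then obtain R where R: "decidable3_in empty_oracle R" "I = {i. \<exists>a. \<forall>b. R i a b}"
    unfolding sigma2_def by auto
  define w where "w i = of_bool (i \<in> I) * (1/2 :: real) ^ pfst i" for i
  have w: "summable w"
    using I unfolding finite_weight_def w_def by simp
  \<comment> \<open>From \<open>n\<close> on, the remaining weight is below 1, so the corresponding
    sets \<open>clo i\<close> cannot cover almost all of the space.\<close>
  then obtain n where n: "norm (\<Sum>i. w (i + n)) < 1"
    using suminf_exist_split[of 1 w] by auto
  \<comment> \<open>For m = (i, a) the condition asks that \<open>i\<close> is among the ignored
    numbers, that the oracle leaves \<open>clo i\<close>, or that \<open>a\<close> is refuted as a
    witness for \<open>i \<in> I\<close>. Only members of \<open>I\<close> have an unrefuted witness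
    and thereby impose avoidance.\<close>
  define T where "T m k c \<longleftrightarrow> pfst m < n \<or>
      (\<exists>j\<le>pfst (pfst m). prod_encode (pfst m, j) < k \<and> \<not> bit c (prod_encode (pfst m, j))) \<or>
      (\<exists>b\<le>k. \<not> R (pfst m) (psnd m) b)" for m k c :: nat
  define U where "U m = {X. \<exists>k. T m k (rst X k)}" for m
  have "decidable3_in empty_oracle T"
    unfolding T_def by (intro comp decidable3[OF R(1)])
  then have U: "uniformly_Sigma1 empty_oracle U"
    by (intro uniformly_Sigma1I[of _ T] semidecidable_decidable) (simp_all add: U_def)
  have U_iff: "X \<in> U m \<longleftrightarrow> pfst m < n \<or> X \<notin> clo (pfst m) \<or> (\<exists>b. \<not> R (pfst m) (psnd m) b)" for X m
  proof
    assume "X \<in> U m"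
    then show "pfst m < n \<or> X \<notin> clo (pfst m) \<or> (\<exists>b. \<not> R (pfst m) (psnd m) b)"
      unfolding U_def T_def clo_def block_def by auto
  next
    assume "pfst m < n \<or> X \<notin> clo (pfst m) \<or> (\<exists>b. \<not> R (pfst m) (psnd m) b)"
    then consider "pfst m < n" | j where "j \<le> pfst (pfst m)" "\<not> X (prod_encode (pfst m, j))"
      | b where "\<not> R (pfst m) (psnd m) b"
      unfolding clo_def block_def by auto
    then show "X \<in> U m"
    proof cases
      case (2 j)
      then have "T m (Suc (prod_encode (pfst m, j))) (rst X (Suc (prod_encode (pfst m, j))))"
        unfolding T_def by auto
      then show ?thesis
        unfolding U_def by blast
    qed (auto simp: U_def T_def)
  qed
  define P where "P = (\<Inter>m. U m)"
  have P: "P = {X. \<forall>i\<ge>n. i \<in> I \<longrightarrow> X \<notin> clo i}"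
  proof (intro set_eqI iffI)
    fix X assume "X \<in> P"
    then have "X \<in> U (prod_encode (i, a))" for i a
      unfolding P_def by auto
    then show "X \<in> {X. \<forall>i\<ge>n. i \<in> I \<longrightarrow> X \<notin> clo i}"
      unfolding U_iff R(2) by simp (meson not_less)
  next
    fix X assume "X \<in> {X. \<forall>i\<ge>n. i \<in> I \<longrightarrow> X \<notin> clo i}"
    then show "X \<in> P"
      unfolding P_def Inter_iff by (auto simp: U_iff R(2)) (meson not_less)
  qed
  have "0 < \<mu> P"
  proof -
    define A where "A i = (if i + n \<in> I then clo (i + n) else {})" for i
    have A_le: "\<mu> (A i) \<le> w (i + n) / 2" for i
      by (simp add: A_def w_def prob_clo)
    have sA: "summable (\<lambda>i. \<mu> (A i))"
    proof (rule summable_comparison_test)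
      show "\<exists>N. \<forall>i\<ge>N. norm (\<mu> (A i)) \<le> w (i + n) / 2"
        using A_le by auto
      show "summable (\<lambda>i. w (i + n) / 2)"
        using w by (intro summable_divide summable_ignore_initial_segment)
    qed
    have "- P = (\<Union>i. A i)"
      unfolding P by (auto simp: A_def) (metis le_add_diff_inverse2)
    also have "\<mu> \<dots> \<le> (\<Sum>i. \<mu> (A i))"
      using sA by (intro coin.finite_measure_subadditive_countably) (auto simp: A_def)
    also have "\<dots> \<le> (\<Sum>i. w (i + n) / 2)"
      using w by (intro suminf_le A_le sA summable_divide summable_ignore_initial_segment)
    also have "\<dots> = (\<Sum>i. w (i + n)) / 2"
      using w by (intro suminf_divide summable_ignore_initial_segment)
    also have "\<dots> < 1"
      using n by auto
    finally have "\<mu> (- P) < 1" .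
    moreover have "P \<in> sets coin_measure"
      unfolding P_def by (intro sets.countable_INT) (auto intro: sets_uniformly_Sigma1[OF U])
    from coin.prob_compl[OF this] have "\<mu> (- P) = 1 - \<mu> P"
      by (simp add: Compl_eq_Diff_UNIV)
    ultimately show ?thesis
      by simp
  qed
  moreover have "Pi2_class empty_oracle P"
    unfolding Pi2_class_def P_def using U by blast
  ultimately obtain Q where Q: "Pi1_class B Q" "Q \<subseteq> P" "\<mu> Q > 0"
    using assms unfolding positive_measure_dominating_def by blast
  have "\<mu> (Q \<inter> clo i) = 0" if "i \<in> I" "n \<le> i" for i
  proof -
    have "Q \<inter> clo i = {}"
      using Q(2) P that by auto
    then show ?thesis
      by simp
  qed
  from null_clo_imp_finite_weight_cover[OF Q(1,3) this]
  show "\<exists>J. ce_in B J \<and> I \<subseteq> J \<and> finite_weight J"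
    by metis
qed

lemma covers_sigma2_imp_LR_reducible:
  assumes "covers_sigma2 B"
  shows "halting_set \<le>\<^sub>L\<^sub>R B"
  unfolding LR_reducible_def
proof (intro allI impI)
  fix Z assume Z: "random_in B Z"
  show "random_in halting_set Z"
  proof (rule ccontr)
    assume "\<not> random_in halting_set Z"
    then obtain U where U: "martin_loef_test halting_set U" "\<And>n. Z \<in> U n"
      unfolding random_in_def by auto
    then have uU: "uniformly_Sigma1 halting_set U" and mU: "\<And>n. \<mu> (U n) \<le> (1/2) ^ n"
      unfolding martin_loef_test_def by auto
    obtain T where T: "decidable3_in halting_set T" "\<And>m. U m = {X. \<exists>k. T m k (rst X k)}"
      "\<And>m X j k. T m j (rst X j) \<Longrightarrow> j \<le> k \<Longrightarrow> T m k (rst X k)"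
      by (rule uniformly_Sigma1E[OF uU]) (rule that; assumption)
    \<comment> \<open>the minimal strings of \<open>U n\<close>; they are prefix-free, so their weights sum to \<open>\<mu> (U n)\<close>\<close>
    define M where "M k n c \<longleftrightarrow> c < 2 ^ k \<and> T n k c \<and> (\<forall>j<k. \<not> T n j (rst (bit c) j))" for k n c :: nat
    \<comment> \<open>A code consists of the length, the test level and the string. The length comes
      first so that the weight of a code is the measure of the cylinder of its string.\<close>
    define I where "I = {w. M (pfst w) (pfst (psnd w)) (psnd (psnd w))}"
    have "decidable3_in halting_set M"
      unfolding M_def by (intro comp decidable3[OF T(1)])
    then have "ce_in halting_set I"
      unfolding ce_in_iff_semidecidable I_def by (intro semidecidable_decidable) simp
    then have "sigma2 I"
      by (rule ce_in_halting_set_imp_sigma2)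
    moreover have "finite_weight I"
    proof (rule finite_weightI)
      fix F assume F: "finite F" "F \<subseteq> I"
      let ?n = "\<lambda>w. pfst (psnd w)"
      let ?E = "\<lambda>w. {X. rst X (pfst w) = psnd (psnd w)}"
      have 1: "(\<Sum>w\<in>{w \<in> F. ?n w = n}. (1/2 :: real) ^ pfst w) \<le> (1/2) ^ n" for n
      proof -
        have less: "psnd (psnd w) < 2 ^ pfst w" if "w \<in> F" for w
          using that F by (auto simp: I_def M_def)
        have "(\<Sum>w\<in>{w \<in> F. ?n w = n}. (1/2 :: real) ^ pfst w) = (\<Sum>w\<in>{w \<in> F. ?n w = n}. \<mu> (?E w))"
          using less by (intro sum.cong) (auto simp: prob_rst_eq)
        also have "\<dots> = \<mu> (\<Union>w\<in>{w \<in> F. ?n w = n}. ?E w)"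
        proof (rule coin.finite_measure_finite_Union[symmetric])
          show "disjoint_family_on ?E {w \<in> F. ?n w = n}"
            unfolding disjoint_family_on_def
          proof (intro ballI impI, rule ccontr)
            fix v w assume vw: "v \<in> {w \<in> F. ?n w = n}" "w \<in> {w \<in> F. ?n w = n}" "v \<noteq> w"
              and "?E v \<inter> ?E w \<noteq> {}"
            then obtain X where X: "rst X (pfst v) = psnd (psnd v)" "rst X (pfst w) = psnd (psnd w)"
              by auto
            have vI: "v \<in> I" "w \<in> I"
              using vw F by auto
            have v: "T n (pfst v) (rst X (pfst v))" "\<And>j. j < pfst v \<Longrightarrow> \<not> T n j (rst X j)"
              using vI vw(1) X(1)[symmetric] unfolding I_def M_def by auto
            have w: "T n (pfst w) (rst X (pfst w))" "\<And>j. j < pfst w \<Longrightarrow> \<not> T n j (rst X j)"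
              using vI vw(2) X(2)[symmetric] unfolding I_def M_def by auto
            from v w have "pfst v = pfst w"
              by (meson linorder_neqE_nat)
            with X vw show False
              by (metis (mono_tags, lifting) mem_Collect_eq pair_pfst_psnd)
          qed
        qed (use F less in \<open>auto intro: prob_rst_eq\<close>)
        also have "\<dots> \<le> \<mu> (U n)"
        proof (rule coin.finite_measure_mono)
          show "(\<Union>w\<in>{w \<in> F. ?n w = n}. ?E w) \<subseteq> U n"
          proof
            fix X assume "X \<in> (\<Union>w\<in>{w \<in> F. ?n w = n}. ?E w)"
            then obtain w where "w \<in> I" "?n w = n" "rst X (pfst w) = psnd (psnd w)"
              using F by auto
            then have "T n (pfst w) (rst X (pfst w))"
              by (auto simp: I_def M_def)
            then show "X \<in> U n"
              unfolding T(2) by blast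
          qed
        qed (rule sets_uniformly_Sigma1[OF uU])
        also have "\<dots> \<le> (1/2) ^ n"
          by (rule mU)
        finally show ?thesis .
      qed
      have "(\<Sum>w\<in>F. (1/2 :: real) ^ pfst w) = (\<Sum>n\<in>?n ` F. \<Sum>w\<in>{w \<in> F. ?n w = n}. (1/2) ^ pfst w)"
        by (rule sum.image_gen[OF F(1)])
      also have "\<dots> \<le> (\<Sum>n\<in>?n ` F. (1/2) ^ n)"
        by (intro sum_mono 1)
      also have "\<dots> \<le> (\<Sum>n. (1/2) ^ n)"
        using F by (intro sum_le_suminf summable_geometric) auto
      finally show "(\<Sum>w\<in>F. (1/2 :: real) ^ pfst w) \<le> (\<Sum>n. (1/2) ^ n)" .
    qed
    ultimately obtain J where J: "ce_in B J" "I \<subseteq> J" "finite_weight J"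
      using assms unfolding covers_sigma2_def by blast
    \<comment> \<open>For each element of the cover, the cylinder of the string it names. Elements
      of \<open>J\<close> outside \<open>I\<close> may fail to name a string of the stated length
      and then give the empty set.\<close>
    define D where "D w = {X. \<exists>k. (w \<in> J \<and> k = pfst w) \<and> rst X k = psnd (psnd w)}" for w
    have "semidecidable_in B (\<lambda>u. (pfst u \<in> J \<and> pfst (psnd u) = pfst (pfst u)) \<and>
        psnd (psnd u) = psnd (psnd (pfst u)))"
      using semidecidable_compose[OF J(1)[unfolded ce_in_iff_semidecidable] computable_pfst_plain]
      by (intro semidecidable_conj) (simp, (intro semidecidable_decidable comp)+)
    then have "uniformly_Sigma1 B D"
      by (rule uniformly_Sigma1I) (simp add: D_def)
    moreover have "summable (\<lambda>w. \<mu> (D w))"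
    proof (rule summable_comparison_test)
      show "summable (\<lambda>w. of_bool (w \<in> J) * (1/2 :: real) ^ pfst w)"
        using J(3) unfolding finite_weight_def .
      have "\<mu> (D w) \<le> of_bool (w \<in> J) * (1/2) ^ pfst w" for w
      proof (cases "w \<in> J \<and> psnd (psnd w) < 2 ^ pfst w")
        case True
        then show ?thesis
          by (simp add: D_def prob_rst_eq)
      next
        case False
        then have "D w = {}"
          by (auto simp: D_def) (metis rst_less)
        then show ?thesis
          by simp
      qed
      then show "\<exists>N. \<forall>w\<ge>N. norm (\<mu> (D w)) \<le> of_bool (w \<in> J) * (1/2) ^ pfst w"
        by auto
    qed
    moreover have "infinite {w. Z \<in> D w}"
    proof -
      \<comment> \<open>The shortest prefix of \<open>Z\<close> that enters level \<open>n\<close>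
        is minimal, hence listed in \<open>I\<close>; different levels give different codes.\<close>
      define k where "k n = (LEAST k. T n k (rst Z k))" for n
      define w where "w n = prod_encode (k n, prod_encode (n, rst Z (k n)))" for n
      have "w n \<in> I" for n
      proof -
        have ex: "\<exists>k. T n k (rst Z k)"
          using U(2)[of n] unfolding T(2) by auto
        have "T n (k n) (rst Z (k n))"
          unfolding k_def by (rule LeastI_ex[OF ex])
        moreover have "\<not> T n j (rst Z j)" if "j < k n" for j
          using that unfolding k_def by (rule not_less_Least)
        ultimately show ?thesis
          unfolding I_def M_def w_def by auto
      qed
      then have "range w \<subseteq> {w. Z \<in> D w}"
        using J(2) unfolding D_def w_def by auto
      moreover have "inj w"
        by (auto simp: inj_def w_def)
      ultimately show ?thesis
        using finite_subset range_inj_infinite by blast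
    qed
    ultimately show False
      using solovay_test Z by blast
  qed
qed

lemma LR_reducible_imp_covers_sigma2:
  assumes LR: "halting_set \<le>\<^sub>L\<^sub>R B"
  shows "covers_sigma2 B"
  unfolding covers_sigma2_def
proof (intro allI impI, rule ccontr)
  fix I assume I: "sigma2 I \<and> finite_weight I"
    and no_cover: "\<nexists>J. ce_in B J \<and> I \<subseteq> J \<and> finite_weight J"
  define tests where "tests = {U. martin_loef_test B U}"
  define t where "t = from_nat_into tests"
  \<comment> \<open>The trivial test shows that the family of tests is nonempty, as the enumeration
    \<open>t\<close> requires.\<close>
  have "martin_loef_test B (\<lambda>_. {})"
  proof -
    have "uniformly_Sigma1 B (\<lambda>_. {})"
      by (rule uniformly_Sigma1I[of _ "\<lambda>_ _ _. False"]) (auto intro!: semidecidable_decidable comp)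
    then show ?thesis
      by (simp add: martin_loef_test_def decseq_def)
  qed
  then have "tests \<noteq> {}"
    unfolding tests_def by blast
  then have range_t: "range t = tests"
    unfolding t_def tests_def by (rule range_from_nat_into[OF _ countable_martin_loef_test])
  then have t: "martin_loef_test B (t e)" for e
    unfolding tests_def by blast
  \<comment> \<open>forcing conditions, and the requirements met on passing from \<open>Q\<close> to \<open>Q'\<close> in step \<open>e\<close>\<close>
  define ok where "ok Q \<longleftrightarrow> Pi1_class B Q \<and> 0 < \<mu> Q" for Q
  define good where "good e Q' Q \<longleftrightarrow> Q' \<subseteq> Q \<and> (\<exists>m. Q' \<inter> t e m = {}) \<and>
      (\<exists>i\<in>I. e \<le> i \<and> Q' \<subseteq> clo i) \<and> (\<exists>b. \<forall>X\<in>Q'. X e = b)" for e Q' Q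
  have step: "\<exists>Q'. ok Q' \<and> good e Q' Q" if okQ: "ok Q" for e Q
  proof -
    \<comment> \<open>Far enough along, the test component is smaller than \<open>Q\<close>, so
      removing it keeps positive measure.\<close>
    obtain m where m: "(1/2 :: real) ^ m < \<mu> Q"
      using real_arch_pow_inv[of "\<mu> Q" "1/2"] okQ unfolding ok_def by auto
    have tm: "Sigma1_class B (t e m)" "\<mu> (t e m) \<le> (1/2) ^ m"
      using t[of e] uniformly_Sigma1_section unfolding martin_loef_test_def by auto
    define Q1 where "Q1 = Q - t e m"
    have Qs: "Q \<in> sets coin_measure"
      using okQ sets_Pi1_class unfolding ok_def by blast
    have "- Q1 = - Q \<union> t e m"
      unfolding Q1_def by auto
    then have Q1: "Pi1_class B Q1"
      using okQ tm Sigma1_class_Un unfolding ok_def Pi1_class_def by metis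
    have "Q \<subseteq> Q1 \<union> t e m"
      unfolding Q1_def by auto
    then have "\<mu> Q \<le> \<mu> (Q1 \<union> t e m)"
      by (intro coin.finite_measure_mono sets.Un sets_Pi1_class[OF Q1] sets_Sigma1_class[OF tm(1)])
    also have "\<dots> \<le> \<mu> Q1 + \<mu> (t e m)"
      using sets_Pi1_class[OF Q1] sets_Sigma1_class[OF tm(1)] by (intro measure_Un_le)
    finally have "0 < \<mu> Q1"
      using m tm by linarith
    \<comment> \<open>If all late \<open>clo i\<close> with \<open>i \<in> I\<close> were null
      inside \<open>Q1\<close>, the set \<open>I\<close> would have a cover of finite
      weight.\<close>
    with Q1 obtain i where i: "i \<in> I" "e \<le> i" "\<mu> (Q1 \<inter> clo i) \<noteq> 0"
      using null_clo_imp_finite_weight_cover[OF Q1, of I e] no_cover by metis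
    define Q2 where "Q2 = Q1 \<inter> clo i"
    have "- Q2 = - Q1 \<union> - clo i"
      unfolding Q2_def by auto
    then have Q2: "Pi1_class B Q2"
      using Q1 Sigma1_class_Compl_clo Sigma1_class_Un unfolding Pi1_class_def by metis
    \<comment> \<open>Fixing bit \<open>e\<close> makes the conditions determine a single point in
      the limit; one of the two halves keeps positive measure.\<close>
    define Q3 where "Q3 b = Q2 \<inter> {X. X e = b}" for b
    have Q3: "Pi1_class B (Q3 b)" for b
    proof -
      have "Sigma1_class B {X. X e \<noteq> b}"
      proof (rule Sigma1_classI)
        show "semidecidable_in B (\<lambda>u. e < pfst u \<and> (bit (psnd u) e \<and> \<not> b \<or> \<not> bit (psnd u) e \<and> b))"
          by (intro semidecidable_decidable comp)
      qed auto
      moreover have "- Q3 b = - Q2 \<union> {X. X e \<noteq> b}"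
        unfolding Q3_def by auto
      ultimately show ?thesis
        using Q2 Sigma1_class_Un unfolding Pi1_class_def by metis
    qed
    have "Q2 = Q3 True \<union> Q3 False"
      unfolding Q3_def by auto
    then have "\<mu> Q2 \<le> \<mu> (Q3 True) + \<mu> (Q3 False)"
      using sets_Pi1_class[OF Q3] measure_Un_le by metis
    moreover have "0 < \<mu> Q2"
      using i(3) unfolding Q2_def by (simp add: zero_less_measure_iff)
    ultimately obtain b where "0 < \<mu> (Q3 b)"
      by (metis add.left_neutral add.right_neutral linorder_not_less measure_nonneg order_antisym_conv order_less_le_trans)
    with Q3 have "ok (Q3 b)"
      unfolding ok_def by blast
    moreover have "good e (Q3 b) Q"
      using i unfolding good_def Q3_def Q2_def Q1_def by blast
    ultimately show ?thesis
      by blast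
  qed
  have "ok UNIV"
  proof -
    have "Pi1_class B UNIV"
      unfolding Pi1_class_def
      by (rule Sigma1_classI[of _ "\<lambda>_ _. False"]) (auto intro!: semidecidable_decidable comp)
    then show ?thesis
      unfolding ok_def using coin.prob_space by simp
  qed
  with step obtain Q where ok: "\<And>e. ok (Q e)" and good: "\<And>e. good e (Q (Suc e)) (Q e)"
    using dependent_nat_choice[of "\<lambda>_. ok" "\<lambda>e Q Q'. good e Q' Q"] by metis
  have "Q (Suc e) \<subseteq> Q e" for e
    using good[of e] unfolding good_def by blast
  then have decr: "Q e \<subseteq> Q d" if "d \<le> e" for d e
    using lift_Suc_antimono_le[of Q, OF _ that] by blast
  have "\<exists>b. \<forall>X\<in>Q (Suc e). X e = b" for e
    using good unfolding good_def by blast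
  then obtain Z where Z: "\<And>e X. X \<in> Q (Suc e) \<Longrightarrow> X e = Z e"
    by metis
  \<comment> \<open>The classes are closed: a prefix of \<open>Z\<close> witnessing that it leaves
    \<open>Q e\<close> would be shared by every member of a later condition, and these are nonempty
    subsets of \<open>Q e\<close>.\<close>
  have ZQ: "Z \<in> Q e" for e
  proof (rule ccontr)
    assume "Z \<notin> Q e"
    have "Sigma1_class B (- Q e)"
      using ok unfolding ok_def Pi1_class_def by blast
    then obtain T where T: "- Q e = {X. \<exists>k. T k (rst X k)}"
      by (rule Sigma1_classE)
    with \<open>Z \<notin> Q e\<close> obtain k where k: "T k (rst Z k)"
      by auto
    have "Q (max e k) \<noteq> {}"
      using ok[of "max e k"] unfolding ok_def by auto
    then obtain Y where Y: "Y \<in> Q (max e k)"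
      by blast
    have "rst Y k = rst Z k"
      using Y decr by (intro rst_cong Z) (meson Suc_leI max.coboundedI2 subsetD)
    with k have "Y \<in> - Q e"
      unfolding T by (auto intro!: exI[of _ k])
    with Y decr[of e "max e k"] show False
      by auto
  qed
  have "random_in B Z"
    unfolding random_in_def
  proof (intro allI impI)
    fix U assume "martin_loef_test B U"
    then obtain e where "U = t e"
      using range_t unfolding tests_def by blast
    with good[of e] ZQ[of "Suc e"] show "Z \<notin> (\<Inter>n. U n)"
      unfolding good_def by blast
  qed
  with LR have "random_in halting_set Z"
    unfolding LR_reducible_def by blast
  moreover have "\<not> random_in halting_set Z"
  proof -
    \<comment> \<open>Since \<open>I\<close> is c.e. in the halting set, the sets
      \<open>clo i\<close> with \<open>i \<in> I\<close> form a Solovay test relative to it, and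
      \<open>Z\<close> meets infinitely many of them by construction.\<close>
    define D where "D i = {X. \<exists>k. i \<in> I \<and> (\<forall>j\<le>pfst i. bit (rst X k) (prod_encode (i, j)))}" for i
    have D: "D i = (if i \<in> I then clo i else {})" for i
    proof -
      have "(\<exists>k. \<forall>j\<le>pfst i. prod_encode (i, j) < k \<and> X (prod_encode (i, j))) \<longleftrightarrow> X \<in> clo i" for X
      proof
        assume "X \<in> clo i"
        moreover have "\<exists>k. \<forall>n\<in>block i. n < k"
          using finite_nat_set_iff_bounded finite_block by blast
        ultimately show "\<exists>k. \<forall>j\<le>pfst i. prod_encode (i, j) < k \<and> X (prod_encode (i, j))"
          unfolding clo_def block_def by auto
      qed (auto simp: clo_def block_def)
      then show ?thesis
        unfolding D_def by auto
    qed
    have "ce_in halting_set I"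
      using I sigma2_imp_ce_in_halting_set by blast
    then have "semidecidable_in halting_set (\<lambda>u. pfst u \<in> I \<and>
        (\<forall>j\<le>pfst (pfst u). bit (psnd (psnd u)) (prod_encode (pfst u, j))))"
      using semidecidable_compose computable_pfst_plain unfolding ce_in_iff_semidecidable
      by (intro semidecidable_conj) (blast, intro semidecidable_decidable comp)
    then have "uniformly_Sigma1 halting_set D"
      by (rule uniformly_Sigma1I) (simp add: D_def)
    moreover have "summable (\<lambda>i. \<mu> (D i))"
    proof (rule summable_comparison_test)
      show "summable (\<lambda>i. of_bool (i \<in> I) * (1/2 :: real) ^ pfst i)"
        using I unfolding finite_weight_def by blast
      show "\<exists>N. \<forall>i\<ge>N. norm (\<mu> (D i)) \<le> of_bool (i \<in> I) * (1/2) ^ pfst i"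
        by (simp add: D prob_clo)
    qed
    moreover have "infinite {i. Z \<in> D i}"
      unfolding infinite_nat_iff_unbounded_le
    proof
      fix e
      from good[of e] obtain i where "i \<in> I" "e \<le> i" "Q (Suc e) \<subseteq> clo i"
        unfolding good_def by blast
      with ZQ[of "Suc e"] show "\<exists>i\<ge>e. i \<in> {i. Z \<in> D i}"
        unfolding D by auto
    qed
    ultimately show ?thesis
      by (rule solovay_test)
  qed
  ultimately show False
    by blast
qed

text \<open>A member of \<open>P\<close> computes how much of itself must be read to enter each
  \<open>U m\<close>. A \<open>B\<close>-computable bound on this function places it in a closed
  subclass of \<open>P\<close>. Almost all of \<open>P\<close> is covered by countably many such
  subclasses, so one of them has positive measure.\<close>

lemma ae_dominating_imp_positive_measure_dominating:
  assumes "ae_dominating B"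
  shows "positive_measure_dominating B"
  unfolding positive_measure_dominating_def
proof (intro allI impI, elim conjE)
  fix P assume "Pi2_class empty_oracle P" and pos: "0 < \<mu> P"
  then obtain U where U: "uniformly_Sigma1 empty_oracle U" "P = (\<Inter>m. U m)"
    unfolding Pi2_class_def by auto
  obtain T where T: "decidable3_in empty_oracle T" "\<And>m. U m = {X. \<exists>k. T m k (rst X k)}"
    "\<And>m X j k. T m j (rst X j) \<Longrightarrow> j \<le> k \<Longrightarrow> T m k (rst X k)"
    by (rule uniformly_Sigma1E[OF U(1)]) (rule that; assumption)
  \<comment> \<open>The constant \<open>c\<close> absorbs the finitely many arguments at which
    domination may fail.\<close>
  define Q where "Q f c = {X. \<forall>m. T m (f m + c) (rst X (f m + c))}" for f :: "nat \<Rightarrow> nat" and c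
  have Q: "Pi1_class B (Q f c)" if f: "f \<le>\<^sub>T B" for f c
    unfolding Pi1_class_def
  proof (rule Sigma1_classI)
    show "semidecidable_in B (\<lambda>u. \<exists>m\<le>pfst u. f m + c \<le> pfst u \<and>
        \<not> T m (f m + c) (rst (bit (psnd u)) (f m + c)))"
      by (intro semidecidable_decidable comp decidable3[OF decidable_in_empty[OF T(1)]]
          computable_compose[OF f])
    show "- Q f c = {X. \<exists>k. \<exists>m\<le>k. f m + c \<le> k \<and> \<not> T m (f m + c) (rst (bit (rst X k)) (f m + c))}"
    proof (intro set_eqI iffI)
      fix X assume "X \<in> - Q f c"
      then obtain m where "\<not> T m (f m + c) (rst X (f m + c))"
        by (auto simp: Q_def)
      then have "m \<le> m + f m + c \<and> f m + c \<le> m + f m + c \<and>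
          \<not> T m (f m + c) (rst (bit (rst X (m + f m + c))) (f m + c))"
        by (simp add: rst_bit_rst)
      then show "X \<in> {X. \<exists>k. \<exists>m\<le>k. f m + c \<le> k \<and> \<not> T m (f m + c) (rst (bit (rst X k)) (f m + c))}"
        by blast
    qed (auto simp: Q_def rst_bit_rst)
  qed
  have Q_sub: "Q f c \<subseteq> P" for f c
    unfolding U(2) T(2) Q_def by auto
  have "\<exists>f c. f \<le>\<^sub>T B \<and> 0 < \<mu> (Q f c)"
  proof (rule ccontr)
    assume "\<not> ?thesis"
    then have null: "Q f c \<in> null_sets coin_measure" if "f \<le>\<^sub>T B" for f c
      using that sets_Pi1_class[OF Q[OF that]] measure_nonneg[of coin_measure]
      by (auto simp: null_sets_def coin.emeasure_eq_measure not_less order.antisym)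
    from countable_computable_in[of B]
    have "AE X in coin_measure. \<forall>f\<in>{f. f \<le>\<^sub>T B}. \<forall>c. X \<notin> Q f c"
      using null by (subst AE_ball_countable) (auto simp: AE_all_countable intro: AE_not_in)
    moreover have "AE X in coin_measure. \<forall>g. g \<le>\<^sub>T X \<longrightarrow> (\<exists>f. f \<le>\<^sub>T B \<and> dominates f g)"
      using assms unfolding ae_dominating_def .
    ultimately have "AE X in coin_measure. X \<notin> P"
    proof eventually_elim
      case (elim X)
      show ?case
      proof
        assume "X \<in> P"
        then have ex: "\<exists>k. T m k (rst X k)" for m
          unfolding U(2) T(2) by auto
        define g where "g = (\<lambda>m. LEAST k. T m k (rst X k))"
        have "g \<le>\<^sub>T X"
          unfolding g_def
          by (intro computable_Least ex comp decidable3[OF decidable_in_empty[OF T(1)]])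
        then obtain f n where f: "f \<le>\<^sub>T B" "\<And>m. n < m \<Longrightarrow> g m \<le> f m"
          using elim(2) unfolding dominates_def by blast
        define c where "c = (\<Sum>m\<le>n. g m)"
        have "g m \<le> f m + c" for m
        proof (cases "n < m")
          case False
          then have "g m \<le> c"
            unfolding c_def by (intro member_le_sum) auto
          then show ?thesis
            by simp
        qed (use f(2)[of m] in simp)
        moreover have "T m (g m) (rst X (g m))" for m
          unfolding g_def by (rule LeastI_ex[OF ex])
        ultimately have "X \<in> Q f c"
          unfolding Q_def using T(3) by blast
        with elim(1) f(1) show False
          by auto
      qed
    qed
    moreover have "P \<in> sets coin_measure"
      unfolding U(2) by (intro sets.countable_INT) (auto intro: sets_uniformly_Sigma1[OF U(1)])
    ultimately have "\<mu> P = 0"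
      by (simp add: coin.prob_eq_0)
    with pos show False
      by simp
  qed
  with Q Q_sub show "\<exists>Q. Pi1_class B Q \<and> Q \<subseteq> P \<and> 0 < \<mu> Q"
    by blast
qed

section \<open>A uniformly dominating function\<close>

definition conv_set :: "nat \<Rightarrow> nat \<Rightarrow> nat \<Rightarrow> cantor set" where
  "conv_set e n t = {X. \<forall>j<n. halts_by X e j t}"

lemma conv_set_rst: "t \<le> k \<Longrightarrow> rst X k = c \<Longrightarrow> bit c \<in> conv_set e n t \<longleftrightarrow> X \<in> conv_set e n t"
  unfolding conv_set_def by auto

lemma decidable_conv_set [comp]:
  assumes "decidable2_in A P" "e \<le>\<^sub>T A" "n \<le>\<^sub>T A" "t \<le>\<^sub>T A"
  shows "decidable_in A (\<lambda>x. P x \<in> conv_set (e x) (n x) (t x))"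
  unfolding conv_set_def mem_Collect_eq
  by (intro comp assms decidable2[OF assms(1)] computable_compose[OF assms(2)]
      computable_compose[OF assms(4)])

lemma conv_set_mono: "t \<le> t' \<Longrightarrow> conv_set e n t \<subseteq> conv_set e n t'"
  unfolding conv_set_def using halts_by_mono by blast

lemma conv_set_anti: "n \<le> n' \<Longrightarrow> conv_set e n' t \<subseteq> conv_set e n t"
  unfolding conv_set_def by auto

lemma sets_conv_set [measurable, simp]: "conv_set e n t \<in> sets coin_measure"
proof -
  have "conv_set e n t = {X. bit (rst X t) \<in> conv_set e n t}"
    using conv_set_rst by blast
  then show ?thesis
    using sets_rst[of "\<lambda>c::nat. bit c \<in> conv_set e n t" t] by simp
qed

lemma scaled_card_le_iff: "N * 2 ^ i \<le> 2 ^ k \<longleftrightarrow> real N / 2 ^ k \<le> (1/2) ^ i"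
proof -
  have "N * 2 ^ i \<le> 2 ^ k \<longleftrightarrow> real (N * 2 ^ i) \<le> real (2 ^ k)"
    by (simp only: of_nat_le_iff)
  then show ?thesis
    by (simp add: power_one_over field_simps)
qed

text \<open>Both sets are decided by the first \<open>s + t\<close> bits, so counting strings of that length measures the difference.\<close>

definition settled :: "nat \<Rightarrow> nat \<Rightarrow> nat \<Rightarrow> nat \<Rightarrow> bool" where
  "settled e n s t \<longleftrightarrow> (\<forall>i\<le>n. card {c::nat. c < 2 ^ (s + t) \<and>
      bit c \<in> conv_set e i s \<and> bit c \<notin> conv_set e i t} * 2 ^ i \<le> 2 ^ (s + t))"

lemma settled_iff: "settled e n s t \<longleftrightarrow> (\<forall>i\<le>n. \<mu> (conv_set e i s - conv_set e i t) \<le> (1/2) ^ i)"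
proof -
  have "card {c::nat. c < 2 ^ (s + t) \<and> bit c \<in> conv_set e i s \<and> bit c \<notin> conv_set e i t} * 2 ^ i
      \<le> 2 ^ (s + t) \<longleftrightarrow> \<mu> (conv_set e i s - conv_set e i t) \<le> (1/2) ^ i" for i
  proof -
    have "conv_set e i s - conv_set e i t =
        {X. bit (rst X (s + t)) \<in> conv_set e i s \<and> bit (rst X (s + t)) \<notin> conv_set e i t}"
      by (auto simp: conv_set_rst[of _ "s + t"])
    then have "\<mu> (conv_set e i s - conv_set e i t) =
        card {c::nat. c < 2 ^ (s + t) \<and> bit c \<in> conv_set e i s \<and> bit c \<notin> conv_set e i t} / 2 ^ (s + t)"
      using prob_rst[of "\<lambda>c::nat. bit c \<in> conv_set e i s \<and> bit c \<notin> conv_set e i t" "s + t"] by simp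
    then show ?thesis
      unfolding scaled_card_le_iff by simp
  qed
  then show ?thesis
    unfolding settled_def by simp
qed

lemma decidable_settled [comp]:
  assumes "e \<le>\<^sub>T A" "n \<le>\<^sub>T A" "s \<le>\<^sub>T A" "t \<le>\<^sub>T A"
  shows "decidable_in A (\<lambda>x. settled (e x) (n x) (s x) (t x))"
  unfolding settled_def
  by (intro comp assms computable_compose[OF assms(1)] computable_compose[OF assms(3)]
      computable_compose[OF assms(4)])

text \<open>Later stages only make the requirement harder, so a candidate once refuted stays
  refuted.\<close>

lemma settled_anti: "settled e n s' t \<Longrightarrow> s \<le> s' \<Longrightarrow> settled e n s t"
  unfolding settled_iff
proof (intro allI impI)
  fix i assume a: "\<forall>i\<le>n. \<mu> (conv_set e i s' - conv_set e i t) \<le> (1/2) ^ i" "s \<le> s'" "i \<le> n"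
  have "\<mu> (conv_set e i s - conv_set e i t) \<le> \<mu> (conv_set e i s' - conv_set e i t)"
    using conv_set_mono[OF a(2)] by (intro coin.finite_measure_mono) auto
  with a show "\<mu> (conv_set e i s - conv_set e i t) \<le> (1/2) ^ i"
    by (meson order_trans)
qed

section \<open>The modulus of convergence\<close>

definition conv_lim :: "nat \<Rightarrow> nat \<Rightarrow> cantor set" where
  "conv_lim e n = (\<Union>t. conv_set e n t)"

lemma sets_conv_lim [measurable, simp]: "conv_lim e n \<in> sets coin_measure"
  unfolding conv_lim_def by simp

lemma LIMSEQ_conv_set: "(\<lambda>t. \<mu> (conv_set e n t)) \<longlonglongrightarrow> \<mu> (conv_lim e n)"
  unfolding conv_lim_def
  by (intro coin.finite_Lim_measure_incseq) (auto simp: incseq_def conv_set_mono)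

lemma conv_set_subset_lim: "conv_set e n t \<subseteq> conv_lim e n"
  unfolding conv_lim_def by auto

lemma prob_conv_lim_diff: "\<mu> (conv_lim e n - conv_set e n t) = \<mu> (conv_lim e n) - \<mu> (conv_set e n t)"
  by (intro coin.finite_measure_Diff conv_set_subset_lim) auto

text \<open>By continuity from below, some stage captures all but 2^-i of the limit set; a sum of
  such stages serves all \<open>i \<le> n\<close> at once.\<close>

lemma ex_settled: "\<exists>t. \<forall>s. settled e n s t"
proof -
  have "\<exists>t. \<forall>s. \<mu> (conv_set e i s - conv_set e i t) \<le> (1/2) ^ i" for i
  proof -
    have "\<mu> (conv_lim e i) - (1/2) ^ i < \<mu> (conv_lim e i)"
      by simp
    from order_tendstoD(1)[OF LIMSEQ_conv_set this]
    obtain t where t: "\<mu> (conv_lim e i) - (1/2) ^ i < \<mu> (conv_set e i t)"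
      by (auto simp: eventually_sequentially)
    have "\<mu> (conv_set e i s - conv_set e i t) \<le> \<mu> (conv_lim e i - conv_set e i t)" for s
      using conv_set_subset_lim by (intro coin.finite_measure_mono) auto
    with t show ?thesis
      unfolding prob_conv_lim_diff by (intro exI[of _ t]) (smt (verit))
  qed
  then obtain t where t: "\<And>i s. \<mu> (conv_set e i s - conv_set e i (t i)) \<le> (1/2) ^ i"
    by metis
  have "\<mu> (conv_set e i s - conv_set e i (\<Sum>i\<le>n. t i)) \<le> (1/2) ^ i" if "i \<le> n" for i s
  proof -
    have "t i \<le> (\<Sum>i\<le>n. t i)"
      using that by (intro member_le_sum) auto
    from conv_set_mono[OF this]
    have "\<mu> (conv_set e i s - conv_set e i (\<Sum>i\<le>n. t i)) \<le> \<mu> (conv_set e i s - conv_set e i (t i))"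
      by (intro coin.finite_measure_mono) auto
    with t show ?thesis
      by (meson order_trans)
  qed
  then show ?thesis
    unfolding settled_iff by blast
qed

definition modulus :: "nat \<Rightarrow> nat \<Rightarrow> nat" where
  "modulus e n = (LEAST t. \<forall>s. settled e n s t)"

lemma settled_modulus: "settled e n s (modulus e n)"
  unfolding modulus_def using LeastI_ex[OF ex_settled] by blast

text \<open>Monotonicity is the reason for which \<open>settled\<close> quantifies over all
  \<open>i \<le> n\<close> rather than treating \<open>n\<close> alone.\<close>

lemma modulus_le_Suc: "modulus e n \<le> modulus e (Suc n)"
  unfolding modulus_def[of e n]
  using settled_modulus[of e "Suc n"] by (intro Least_le) (auto simp: settled_def)

lemma prob_conv_lim_modulus: "\<mu> (conv_lim e n - conv_set e n (modulus e n)) \<le> (1/2) ^ n"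
proof -
  have "\<mu> (conv_set e n s) \<le> \<mu> (conv_set e n (modulus e n)) + (1/2) ^ n" for s
  proof -
    have "\<mu> (conv_set e n s) \<le> \<mu> (conv_set e n (modulus e n) \<union> (conv_set e n s - conv_set e n (modulus e n)))"
      by (intro coin.finite_measure_mono) auto
    also have "\<dots> \<le> \<mu> (conv_set e n (modulus e n)) + \<mu> (conv_set e n s - conv_set e n (modulus e n))"
      by (intro measure_Un_le) auto
    also have "\<mu> (conv_set e n s - conv_set e n (modulus e n)) \<le> (1/2) ^ n"
      using settled_modulus unfolding settled_iff by blast
    finally show ?thesis
      by simp
  qed
  then have "\<mu> (conv_lim e n) \<le> \<mu> (conv_set e n (modulus e n)) + (1/2) ^ n"
    by (intro LIMSEQ_le_const2[OF LIMSEQ_conv_set]) auto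
  then show ?thesis
    unfolding prob_conv_lim_diff by simp
qed

definition current :: "nat \<Rightarrow> nat \<Rightarrow> nat \<Rightarrow> nat \<Rightarrow> bool" where
  "current e n s t \<longleftrightarrow> settled e n s t \<and> (\<forall>t'<t. \<not> settled e n s t')"

lemma decidable_current [comp]:
  assumes "e \<le>\<^sub>T A" "n \<le>\<^sub>T A" "s \<le>\<^sub>T A" "t \<le>\<^sub>T A"
  shows "decidable_in A (\<lambda>x. current (e x) (n x) (s x) (t x))"
  unfolding current_def
  by (intro comp assms computable_compose[OF assms(1)] computable_compose[OF assms(2)]
      computable_compose[OF assms(3)])

lemma ex_not_settled: "\<exists>s. \<forall>t<modulus e n. \<not> settled e n s t"
proof -
  have "\<exists>s. \<not> settled e n s t" if "t < modulus e n" for t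
    using that not_less_Least unfolding modulus_def by blast
  then obtain s where s: "\<And>t. t < modulus e n \<Longrightarrow> \<not> settled e n (s t) t"
    by metis
  have "\<not> settled e n (\<Sum>t<modulus e n. s t) t" if "t < modulus e n" for t
  proof -
    have "s t \<le> (\<Sum>t<modulus e n. s t)"
      using that by (intro member_le_sum) auto
    with s[OF that] show ?thesis
      using settled_anti by blast
  qed
  then show ?thesis
    by blast
qed

text \<open>Every candidate below the modulus is eventually refuted, and the modulus itself never
  is.\<close>

lemma current_eventually: "\<exists>s\<^sub>0. \<forall>s\<ge>s\<^sub>0. \<forall>t. current e n s t \<longleftrightarrow> t = modulus e n"
proof -
  obtain s\<^sub>0 where s\<^sub>0: "\<And>t. t < modulus e n \<Longrightarrow> \<not> settled e n s\<^sub>0 t"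
    using ex_not_settled by blast
  have "current e n s t \<longleftrightarrow> t = modulus e n" if "s\<^sub>0 \<le> s" for s t
  proof -
    have "\<not> settled e n s t" if "t < modulus e n" for t
      using s\<^sub>0[OF that] settled_anti \<open>s\<^sub>0 \<le> s\<close> by blast
    then show ?thesis
      using settled_modulus[of e n s] unfolding current_def by (metis linorder_neqE_nat)
  qed
  then show ?thesis
    by blast
qed

section \<open>Oracles lost between consecutive arguments\<close>

definition drop_set :: "nat \<Rightarrow> nat \<Rightarrow> nat \<Rightarrow> cantor set" where
  "drop_set e n t = conv_set e n t - conv_set e (Suc n) t"

lemma sets_drop_set [measurable, simp]: "drop_set e n t \<in> sets coin_measure"
  unfolding drop_set_def by simp

lemma drop_set_rst: "t \<le> k \<Longrightarrow> rst X k = c \<Longrightarrow> bit c \<in> drop_set e n t \<longleftrightarrow> X \<in> drop_set e n t"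
  unfolding drop_set_def using conv_set_rst by blast

lemma decidable_drop_set [comp]:
  assumes "decidable2_in A P" "e \<le>\<^sub>T A" "n \<le>\<^sub>T A" "t \<le>\<^sub>T A"
  shows "decidable_in A (\<lambda>x. P x \<in> drop_set (e x) (n x) (t x))"
  unfolding drop_set_def Diff_iff by (intro comp assms)

text \<open>The largest \<open>l \<le> n\<close> such that \<open>drop_set e n t\<close> has measure at most \<open>2\<^sup>-\<^sup>l\<close>.\<close>

definition drop_level :: "nat \<Rightarrow> nat \<Rightarrow> nat \<Rightarrow> nat" where
  "drop_level e n t =
    card {l. l < n \<and> card {c::nat. c < 2 ^ t \<and> bit c \<in> drop_set e n t} * 2 ^ Suc l \<le> 2 ^ t}"

lemma computable_drop_level [comp]:
  assumes "e \<le>\<^sub>T A" "n \<le>\<^sub>T A" "t \<le>\<^sub>T A"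
  shows "(\<lambda>x. drop_level (e x) (n x) (t x)) \<le>\<^sub>T A"
  unfolding drop_level_def
  by (intro comp assms computable_compose[OF assms(1)] computable_compose[OF assms(2)]
      computable_compose[OF assms(3)])

text \<open>The numbers counted form an initial segment, so their cardinality is the largest
  admissible level. Failure of the next level gives the factor 2; stopping at the cap
  \<open>n\<close> gives the summand 2^-n.\<close>

lemma drop_level_bounds:
  shows "\<mu> (drop_set e n t) \<le> (1/2) ^ drop_level e n t"
    and "(1/2) ^ drop_level e n t \<le> 2 * \<mu> (drop_set e n t) + (1/2) ^ n"
proof -
  let ?m = "\<mu> (drop_set e n t)"
  have m: "?m = card {c::nat. c < 2 ^ t \<and> bit c \<in> drop_set e n t} / 2 ^ t"
  proof -
    have "drop_set e n t = {X. bit (rst X t) \<in> drop_set e n t}"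
      using drop_set_rst by blast
    then show ?thesis
      using prob_rst[of "\<lambda>c::nat. bit c \<in> drop_set e n t" t] by simp
  qed
  define S where "S = {l. l < n \<and> ?m \<le> (1/2) ^ Suc l}"
  have "drop_level e n t = card S"
  proof -
    have "card {c::nat. c < 2 ^ t \<and> bit c \<in> drop_set e n t} * 2 ^ Suc l \<le> 2 ^ t \<longleftrightarrow> ?m \<le> (1/2) ^ Suc l" for l
      unfolding m by (rule scaled_card_le_iff)
    then show ?thesis
      unfolding drop_level_def S_def by simp
  qed
  moreover have "S = {..<card S}"
  proof -
    have fin: "finite S"
      by (simp add: S_def)
    have down: "l \<in> S" if "k \<in> S" "l \<le> k" for k l
    proof -
      have "(1/2 :: real) ^ Suc k \<le> (1/2) ^ Suc l"
        using that by (intro power_decreasing) auto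
      with that show ?thesis
        unfolding S_def mem_Collect_eq by (meson order_trans le_less_trans)
    qed
    have "\<exists>N. S = {..<N}"
    proof (intro exI set_eqI iffI)
      let ?N = "LEAST l. l \<notin> S"
      have ex: "\<exists>l. l \<notin> S"
        using fin infinite_UNIV_nat by (metis UNIV_eq_I)
      show "l \<in> {..<?N}" if "l \<in> S" for l
        using that down LeastI_ex[OF ex] by (meson lessThan_iff linorder_not_less)
      show "l \<in> S" if "l \<in> {..<?N}" for l
        using that not_less_Least by auto
    qed
    then show ?thesis
      by auto
  qed
  ultimately have S: "S = {..<drop_level e n t}"
    by simp
  show "?m \<le> (1/2) ^ drop_level e n t"
  proof (cases "drop_level e n t")
    case (Suc l)
    then have "l \<in> S"
      unfolding S by simp
    then show ?thesis
      unfolding S_def Suc by simp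
  qed simp
  have "drop_level e n t \<notin> S"
    unfolding S by simp
  moreover have "drop_level e n t \<le> n"
  proof -
    have "S \<subseteq> {..<n}"
      unfolding S_def by auto
    then show ?thesis
      unfolding S by (metis card_lessThan card_mono finite_lessThan)
  qed
  ultimately have "drop_level e n t = n \<or> (1/2) ^ Suc (drop_level e n t) < ?m"
    unfolding S_def by auto
  then show "(1/2) ^ drop_level e n t \<le> 2 * ?m + (1/2) ^ n"
    by (auto simp: add_increasing2 add_increasing)
qed

text \<open>The first component makes the weight 2^-e times the measure of the drop set, rounded up
  to a power of 1/2. The factor 2^-e allows summing over all \<open>e\<close>; the other components
  make the code injective.\<close>

definition item :: "nat \<Rightarrow> nat \<Rightarrow> nat \<Rightarrow> nat" where
  "item e n t = prod_encode (e + drop_level e n t, prod_encode (e, prod_encode (n, t)))"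

lemma computable_item [comp]:
  assumes "e \<le>\<^sub>T A" "n \<le>\<^sub>T A" "t \<le>\<^sub>T A"
  shows "(\<lambda>x. item (e x) (n x) (t x)) \<le>\<^sub>T A"
  unfolding item_def by (intro comp assms)

lemma item_eq_iff [simp]: "item e n t = item e' n' t' \<longleftrightarrow> e = e' \<and> n = n' \<and> t = t'"
  unfolding item_def by auto

definition true_items :: "nat set" where
  "true_items = {item e n (modulus e (Suc n)) | e n. True}"

lemma sigma2_true_items: "sigma2 true_items"
proof -
  \<comment> \<open>Here \<open>a\<close> is a stage by which all smaller guesses are refuted, and
    \<open>b\<close> ranges over the stages that could refute \<open>t\<close>. An item is at least
    as large as its components, so bounded quantifiers suffice.\<close>
  define R where "R w a b \<longleftrightarrow>
      (\<exists>e\<le>w. \<exists>n\<le>w. \<exists>t\<le>w. w = item e n t \<and> settled e (Suc n) b t \<and> (\<forall>t'<t. \<not> settled e (Suc n) a t'))"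
    for w a b
  have "decidable3_in empty_oracle R"
    unfolding R_def by (intro comp)
  moreover have "w \<in> true_items \<longleftrightarrow> (\<exists>a. \<forall>b. R w a b)" for w
  proof
    assume "w \<in> true_items"
    then obtain e n where w: "w = item e n (modulus e (Suc n))"
      unfolding true_items_def by auto
    obtain a where a: "\<And>t. t < modulus e (Suc n) \<Longrightarrow> \<not> settled e (Suc n) a t"
      using ex_not_settled by blast
    have "e \<le> w" "n \<le> w" "modulus e (Suc n) \<le> w"
      unfolding w item_def by (meson le_prod_encode_1 le_prod_encode_2 le_trans)+
    then have "\<forall>b. R w a b"
      unfolding R_def using w a settled_modulus by blast
    then show "\<exists>a. \<forall>b. R w a b" ..
  next
    assume "\<exists>a. \<forall>b. R w a b"
    then obtain a where a: "\<And>b. R w a b"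
      by blast
    from a[of 0] obtain e n t where w: "w = item e n t" and less: "\<And>t'. t' < t \<Longrightarrow> \<not> settled e (Suc n) a t'"
      unfolding R_def by blast
    have all: "settled e (Suc n) b t" for b
      using a[of b] unfolding R_def w by auto
    have "t = modulus e (Suc n)"
    proof (rule order.antisym)
      show "t \<le> modulus e (Suc n)"
        using less settled_modulus by (meson linorder_not_less)
      show "modulus e (Suc n) \<le> t"
        unfolding modulus_def using all by (intro Least_le) auto
    qed
    with w show "w \<in> true_items"
      unfolding true_items_def by auto
  qed
  ultimately show ?thesis
    unfolding sigma2_def by blast
qed

lemma sum_geometric_le: "finite F \<Longrightarrow> (\<Sum>n\<in>F. (1/2 :: real) ^ n) \<le> 2"
  using sum_le_suminf[OF summable_geometric[of "1/2 :: real"], of F] by (simp add: suminf_geometric)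

text \<open>At the modulus for n + 1 the sets are within 2^-(n+1) of the limit where it matters, so
  the losses are bounded by a telescoping sum plus a geometric one.\<close>

lemma sum_prob_drop_set_le: "(\<Sum>n<N. \<mu> (drop_set e n (modulus e (Suc n)))) \<le> 3"
proof -
  have 1: "\<mu> (drop_set e n (modulus e (Suc n))) \<le>
      \<mu> (conv_lim e n) - \<mu> (conv_lim e (Suc n)) + (1/2) ^ Suc n" for n
  proof -
    let ?t = "modulus e (Suc n)"
    have "\<mu> (drop_set e n ?t) = \<mu> (conv_set e n ?t) - \<mu> (conv_set e (Suc n) ?t)"
      unfolding drop_set_def by (intro coin.finite_measure_Diff conv_set_anti) auto
    moreover have "\<mu> (conv_set e n ?t) \<le> \<mu> (conv_lim e n)"
      by (intro coin.finite_measure_mono conv_set_subset_lim) auto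
    moreover have "\<mu> (conv_lim e (Suc n)) - \<mu> (conv_set e (Suc n) ?t) \<le> (1/2) ^ Suc n"
      using prob_conv_lim_modulus[of e "Suc n"] unfolding prob_conv_lim_diff .
    ultimately show ?thesis
      by linarith
  qed
  have "(\<Sum>n<N. \<mu> (drop_set e n (modulus e (Suc n)))) \<le>
      (\<Sum>n<N. \<mu> (conv_lim e n) - \<mu> (conv_lim e (Suc n)) + (1/2) ^ Suc n)"
    by (intro sum_mono 1)
  also have "\<dots> = \<mu> (conv_lim e 0) - \<mu> (conv_lim e N) + (\<Sum>n<N. (1/2) ^ n) / 2"
    using sum_lessThan_telescope'[of "\<lambda>n. \<mu> (conv_lim e n)" N]
    by (simp add: sum.distrib sum_divide_distrib)
  also have "\<dots> \<le> 1 - 0 + 2 / 2"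
    by (intro add_mono diff_mono divide_right_mono sum_geometric_le) auto
  finally show ?thesis
    by simp
qed

lemma finite_weight_true_items: "finite_weight true_items"
proof (rule finite_weightI)
  fix F assume F: "finite F" "F \<subseteq> true_items"
  define it where "it = (\<lambda>(e, n). item e n (modulus e (Suc n)))"
  have "F \<subseteq> range it"
  proof
    fix w assume "w \<in> F"
    then obtain e n where "w = it (e, n)"
      using F unfolding true_items_def it_def by auto
    then show "w \<in> range it" by blast
  qed
  from finite_subset_image[OF F(1) this] obtain G where G: "finite G" "F = it ` G"
    by auto
  obtain N where N: "G \<subseteq> {..<N} \<times> {..<N}"
  proof -
    obtain N where "\<forall>x\<in>fst ` G \<union> snd ` G. x < N"
      using finite_nat_set_iff_bounded[of "fst ` G \<union> snd ` G"] G(1) by auto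
    then show thesis
      by (intro that[of N]) force
  qed
  have "inj_on it G"
    by (auto simp: inj_on_def it_def)
  then have "(\<Sum>w\<in>F. (1/2 :: real) ^ pfst w) = (\<Sum>x\<in>G. (1/2) ^ pfst (it x))"
    unfolding G(2) by (rule sum.reindex_cong) auto
  also have "\<dots> \<le> (\<Sum>x\<in>{..<N} \<times> {..<N}. (1/2) ^ pfst (it x))"
    using N by (intro sum_mono2) auto
  also have "\<dots> = (\<Sum>e<N. \<Sum>n<N. (1/2) ^ e * (1/2) ^ drop_level e n (modulus e (Suc n)))"
    by (simp add: sum.cartesian_product it_def item_def power_add split_beta)
  \<comment> \<open>For fixed \<open>e\<close>, rounding to levels costs a factor 2 and a geometric
    series: 2 * 3 + 2 = 8.\<close>
  also have "\<dots> \<le> (\<Sum>e<N. (1/2) ^ e * 8)"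
  proof (intro sum_mono)
    fix e
    have "(\<Sum>n<N. (1/2 :: real) ^ drop_level e n (modulus e (Suc n))) \<le>
        (\<Sum>n<N. 2 * \<mu> (drop_set e n (modulus e (Suc n))) + (1/2) ^ n)"
      by (intro sum_mono drop_level_bounds)
    also have "\<dots> \<le> 2 * 3 + 2"
      by (simp only: sum.distrib sum_distrib_left[symmetric])
        (intro add_mono mult_left_mono sum_prob_drop_set_le sum_geometric_le; simp)
    finally show "(\<Sum>n<N. (1/2 :: real) ^ e * (1/2) ^ drop_level e n (modulus e (Suc n))) \<le> (1/2) ^ e * 8"
      by (simp only: sum_distrib_left[symmetric]) (intro mult_left_mono; simp)
  qed
  also have "\<dots> \<le> 2 * 8"
    by (simp only: sum_distrib_right[symmetric]) (intro mult_right_mono sum_geometric_le; simp)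
  finally show "(\<Sum>w\<in>F. (1/2 :: real) ^ pfst w) \<le> 2 * 8" .
qed

lemma covers_sigma2_imp_uniformly_ae_dominating:
  assumes "covers_sigma2 B"
  shows "uniformly_ae_dominating B"
proof -
  obtain J where J: "ce_in B J" "true_items \<subseteq> J" "finite_weight J"
    using assms sigma2_true_items finite_weight_true_items unfolding covers_sigma2_def by blast
  obtain S where S: "decidable2_in B S" "\<And>w. w \<in> J \<longleftrightarrow> (\<exists>s. S w s)"
    "\<And>w s t. S w s \<Longrightarrow> s \<le> t \<Longrightarrow> S w t"
    by (rule semidecidable_monotone_stages[OF J(1)[unfolded ce_in_iff_semidecidable]])
      (rule that; assumption)
  \<comment> \<open>
    Parameters \<open>e\<close>, \<open>j\<close>, \<open>m\<close> describe a \<open>\<Pi>\<^sub>1\<close> class relative to \<open>B\<close>: from stage \<open>j\<close> on, \<open>X\<close> has to converge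
    below \<open>m\<close> by the currently guessed modulus, and must not be dropped at any \<open>n \<ge> m\<close> whose guess is
    confirmed by the cover \<open>J\<close>.  \<open>exc\<close> says that \<open>X\<close> has been excluded by stage \<open>s\<close>.  Members of the
    class converge everywhere, whatever the parameters are.
  \<close>
  define exc where "exc e j m s X \<longleftrightarrow> (\<exists>s'\<le>s. j \<le> s' \<and>
      ((\<exists>t\<le>s'. current e m s' t \<and> X \<notin> conv_set e m t) \<or>
       (\<exists>n\<le>s'. \<exists>t\<le>s'. m \<le> n \<and> S (item e n t) s' \<and> current e (Suc n) s' t \<and> X \<in> drop_set e n t)))"
    for e j m s X
  \<comment> \<open>The number \<open>i\<close> encodes the parameters \<open>(e, (j, m))\<close>. A
    bad oracle at stage \<open>s\<close> has neither converged below \<open>n\<close> nor been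
    excluded.\<close>
  define bad where "bad i n s X \<longleftrightarrow> X \<notin> conv_set (pfst i) n s \<and>
      \<not> exc (pfst i) (pfst (psnd i)) (psnd (psnd i)) s X" for i n s X
  \<comment> \<open>All convergence stages inspected by stage \<open>s\<close> are at most
    \<open>s\<close>, so the first \<open>s\<close> bits decide badness and its measure can be
    counted.\<close>
  have bad_rst: "bad i n s (bit (rst X s)) \<longleftrightarrow> bad i n s X" for i n s X
  proof -
    have "bit (rst X s) \<in> conv_set e n t \<longleftrightarrow> X \<in> conv_set e n t"
      "bit (rst X s) \<in> drop_set e n t \<longleftrightarrow> X \<in> drop_set e n t" if "t \<le> s" for e n t
      using that by (simp_all add: conv_set_rst drop_set_rst)
    then show ?thesis
      unfolding bad_def exc_def by (simp cong: conj_cong)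
  qed
  have sets_bad [simp]: "{X. bad i n s X} \<in> sets coin_measure" for i n s
    using sets_rst[of "\<lambda>c::nat. bad i n s (bit c)" s] by (simp only: bad_rst)
  have bad_anti: "bad i n s X" if "bad i n t X" "s \<le> t" for i n s t X
    using that conv_set_mono[OF that(2)] unfolding bad_def exc_def by (meson le_trans subsetD)

  \<comment> \<open>An oracle never excluded converges everywhere: by induction on
    \<open>k \<ge> m\<close>, it converges below \<open>k\<close> by the modulus. In the inductive
    step the true guess is eventually current and confirmed by \<open>J\<close>, so not being
    excluded means not being dropped.\<close>
  have not_always_bad: "\<exists>s. \<not> bad i n s X" for i n X
  proof (rule ccontr)
    assume "\<not> ?thesis"
    then have bad: "bad i n s X" for s
      by blast
    define e j m where "e = pfst i" and "j = pfst (psnd i)" and "m = psnd (psnd i)"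
    from bad have no_exc: "\<not> exc e j m s X" and no_conv: "X \<notin> conv_set e n s" for s
      unfolding bad_def e_def j_def m_def by auto
    have ge: "X \<in> conv_set e k (modulus e k)" if "m \<le> k" for k
      using that
    proof (induction k rule: dec_induct)
      case base
      obtain s\<^sub>0 where s\<^sub>0: "\<And>s. s\<^sub>0 \<le> s \<Longrightarrow> current e m s (modulus e m)"
        using current_eventually by blast
      define s where "s = s\<^sub>0 + j + modulus e m"
      have "current e m s (modulus e m)" "j \<le> s" "modulus e m \<le> s"
        by (auto simp: s_def intro: s\<^sub>0)
      with no_exc[of s] show ?case
        unfolding exc_def by blast
    next
      case (step k)
      let ?t = "modulus e (Suc k)"
      have "item e k ?t \<in> J"
        using J(2) unfolding true_items_def by blast
      then obtain s\<^sub>1 where s\<^sub>1: "S (item e k ?t) s\<^sub>1"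
        using S(2) by blast
      obtain s\<^sub>0 where s\<^sub>0: "\<And>s. s\<^sub>0 \<le> s \<Longrightarrow> current e (Suc k) s ?t"
        using current_eventually by blast
      define s where "s = s\<^sub>0 + s\<^sub>1 + j + k + ?t"
      have "current e (Suc k) s ?t" "j \<le> s" "k \<le> s" "?t \<le> s" "S (item e k ?t) s"
        by (auto simp: s_def intro: s\<^sub>0 S(3)[OF s\<^sub>1])
      with no_exc[of s] step.hyps have "X \<notin> drop_set e k ?t"
        unfolding exc_def by blast
      moreover have "X \<in> conv_set e k ?t"
        using step.IH conv_set_mono[OF modulus_le_Suc] by blast
      ultimately show ?case
        unfolding drop_set_def by blast
    qed
    have "X \<in> conv_set e n (modulus e (max m n))"
      using ge[of "max m n"] conv_set_anti[of n "max m n"] by auto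
    with no_conv show False
      by blast
  qed

  have bad_lim: "(\<lambda>s. \<mu> {X. bad i n s X}) \<longlonglongrightarrow> 0" for i n
  proof -
    have "(\<lambda>s. \<mu> {X. bad i n s (bit (rst X s))}) \<longlonglongrightarrow> \<mu> {X. \<forall>s. bad i n s (bit (rst X s))}"
      by (rule LIMSEQ_prob_decr[of "\<lambda>s c. bad i n s (bit c)"]) (simp add: bad_rst bad_anti)
    moreover have "{X. \<forall>s. bad i n s (bit (rst X s))} = {}"
      using not_always_bad by (auto simp: bad_rst)
    ultimately show ?thesis
      by (simp only: bad_rst measure_empty)
  qed

  \<comment> \<open>Convergence below \<open>Suc n\<close> includes the argument \<open>n\<close> at
    which domination is wanted. Each class is considered from \<open>n = i\<close> on, and the
    bounds 2^-n are summable.\<close>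
  define good where "good n s \<longleftrightarrow>
      (\<forall>i\<le>n. card {c::nat. c < 2 ^ s \<and> bad i (Suc n) s (bit c)} * 2 ^ n \<le> 2 ^ s)" for n s
  have good_iff: "good n s \<longleftrightarrow> (\<forall>i\<le>n. \<mu> {X. bad i (Suc n) s X} \<le> (1/2) ^ n)" for n s
  proof -
    have "\<mu> {X. bad i (Suc n) s X} = card {c::nat. c < 2 ^ s \<and> bad i (Suc n) s (bit c)} / 2 ^ s" for i
      using prob_rst[of "\<lambda>c::nat. bad i (Suc n) s (bit c)" s] by (simp only: bad_rst)
    then show ?thesis
      unfolding good_def scaled_card_le_iff by simp
  qed
  have ex_good: "\<exists>s. good n s" for n
  proof -
    have "eventually (\<lambda>s. \<mu> {X. bad i (Suc n) s X} < (1/2) ^ n) sequentially" for i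
      by (rule order_tendstoD(2)[OF bad_lim]) simp
    then have "eventually (\<lambda>s. \<forall>i\<in>{..n}. \<mu> {X. bad i (Suc n) s X} < (1/2) ^ n) sequentially"
      by (intro eventually_ball_finite) auto
    then obtain s where "\<forall>i\<in>{..n}. \<mu> {X. bad i (Suc n) s X} < (1/2) ^ n"
      by (auto simp: eventually_sequentially)
    then show ?thesis
      unfolding good_iff by (intro exI[of _ s]) (auto intro: less_imp_le)
  qed
  \<comment> \<open>\<open>f n\<close> waits until few oracles in the first \<open>n\<close> classes have neither converged nor been excluded\<close>
  define f where "f = (\<lambda>n. LEAST s. good n s)"
  have "decidable2_in B good"
    unfolding good_def bad_def exc_def by (intro comp decidable2[OF S(1)])
  then have f: "f \<le>\<^sub>T B"
    unfolding f_def using ex_good by (rule computable_Least)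
  have good_f: "good n (f n)" for n
    unfolding f_def by (rule LeastI_ex[OF ex_good])

  \<comment> \<open>First use of Borel-Cantelli: for each class, almost every oracle is eventually
    handled in time by \<open>f\<close>.\<close>
  have "AE X in coin_measure. eventually (\<lambda>n. \<not> bad i (Suc n) (f n) X) sequentially" for i
  proof -
    define A where "A n = (if i \<le> n then {X. bad i (Suc n) (f n) X} else {})" for n
    have "\<mu> (A n) \<le> (1/2) ^ n" for n
      using good_f[of n] unfolding good_iff A_def by auto
    then have "summable (\<lambda>n. \<mu> (A n))"
      by (intro summable_comparison_test[OF _ summable_geometric[of "1/2 :: real"]]) auto
    then have "AE X in coin_measure. eventually (\<lambda>n. X \<in> space coin_measure - A n) sequentially"
      by (intro borel_cantelli_AE1) (auto simp: A_def coin.emeasure_eq_measure)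
    then show ?thesis
    proof eventually_elim
      case (elim X)
      then show ?case
        using eventually_ge_at_top[of i] by eventually_elim (auto simp: A_def)
    qed
  qed
  then have AE1: "AE X in coin_measure. \<forall>i. eventually (\<lambda>n. \<not> bad i (Suc n) (f n) X) sequentially"
    by (simp add: AE_all_countable)

  \<comment> \<open>Second use: almost every oracle on which a functional is total eventually
    converges by the modulus.\<close>
  have "AE X in coin_measure. eventually (\<lambda>n. X \<notin> conv_lim e n - conv_set e n (modulus e n)) sequentially" for e
  proof -
    have "summable (\<lambda>n. \<mu> (conv_lim e n - conv_set e n (modulus e n)))"
      by (intro summable_comparison_test[OF _ summable_geometric[of "1/2 :: real"]])
        (auto intro: prob_conv_lim_modulus)
    then have "AE X in coin_measure. eventually (\<lambda>n. X \<in> space coin_measure -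
        (conv_lim e n - conv_set e n (modulus e n))) sequentially"
      by (intro borel_cantelli_AE1) (auto simp: coin.emeasure_eq_measure)
    then show ?thesis
      by simp
  qed
  then have AE2: "AE X in coin_measure. \<forall>e.
      eventually (\<lambda>n. X \<notin> conv_lim e n - conv_set e n (modulus e n)) sequentially"
    by (simp add: AE_all_countable)

  define K where "K w = drop_set (pfst (psnd w)) (pfst (psnd (psnd w))) (psnd (psnd (psnd w)))" for w
  have K_item: "K (item e n t) = drop_set e n t" for e n t
    unfolding K_def item_def by simp
  \<comment> \<open>Third use: for each functional, the cover names only finitely many drop sets
    containing a given oracle. For fixed \<open>e\<close> the factor 2^-e in the weights is undone
    by a constant.\<close>
  have "AE X in coin_measure. finite {w \<in> J. X \<in> K w \<and> (\<exists>n t. w = item e n t)}" for e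
  proof -
    define A where "A w = (if w \<in> J \<and> (\<exists>n t. w = item e n t) then K w else {})" for w
    have "\<mu> (A w) \<le> 2 ^ e * (of_bool (w \<in> J) * (1/2) ^ pfst w)" for w
    proof (cases "w \<in> J \<and> (\<exists>n t. w = item e n t)")
      case True
      then obtain n t where w: "w = item e n t" "w \<in> J"
        by blast
      have "\<mu> (drop_set e n t) \<le> (1/2) ^ drop_level e n t"
        by (rule drop_level_bounds)
      also have "\<dots> = 2 ^ e * (1/2) ^ pfst w"
        unfolding w item_def by (simp add: power_add power_one_over)
      finally show ?thesis
        using True w K_item by (simp add: A_def)
    qed (auto simp: A_def)
    then have "\<exists>N. \<forall>w\<ge>N. norm (\<mu> (A w)) \<le> 2 ^ e * (of_bool (w \<in> J) * (1/2) ^ pfst w)"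
      by simp
    moreover have "summable (\<lambda>w. 2 ^ e * (of_bool (w \<in> J) * (1/2 :: real) ^ pfst w))"
      using J(3) unfolding finite_weight_def by (rule summable_mult)
    ultimately have "summable (\<lambda>w. \<mu> (A w))"
      by (rule summable_comparison_test)
    then have "AE X in coin_measure. eventually (\<lambda>w. X \<in> space coin_measure - A w) sequentially"
      by (intro borel_cantelli_AE1) (auto simp: A_def K_def coin.emeasure_eq_measure)
    then show ?thesis
    proof eventually_elim
      case (elim X)
      then obtain N where N: "\<And>w. N \<le> w \<Longrightarrow> X \<notin> A w"
        by (auto simp: eventually_sequentially)
      have "{w \<in> J. X \<in> K w \<and> (\<exists>n t. w = item e n t)} \<subseteq> {..<N}"
      proof
        fix w assume "w \<in> {w \<in> J. X \<in> K w \<and> (\<exists>n t. w = item e n t)}"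
        then have "X \<in> A w"
          unfolding A_def by auto
        with N show "w \<in> {..<N}"
          by (meson lessThan_iff linorder_not_less)
      qed
      then show ?case
        using finite_subset by blast
    qed
  qed
  then have AE3: "AE X in coin_measure. \<forall>e. finite {w \<in> J. X \<in> K w \<and> (\<exists>n t. w = item e n t)}"
    by (simp add: AE_all_countable)

  have "AE X in coin_measure. \<forall>g. g \<le>\<^sub>T X \<longrightarrow> dominates f g"
    using AE1 AE2 AE3
  proof eventually_elim
    case (elim X)
    show ?case
    proof (intro allI impI)
      fix g assume "g \<le>\<^sub>T X"
      then obtain p where p: "\<And>n. eval X p n (g n)"
        unfolding computable_in_def by auto
      define e where "e = index p"
      have lim: "X \<in> conv_lim e n" for n
      proof -
        have "\<exists>t. halts_by X e j t" for j
          unfolding e_def using eval_halts_by[OF p] .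
        then obtain t where t: "\<And>j. halts_by X e j (t j)"
          by metis
        have "halts_by X e j (\<Sum>j<n. t j)" if "j < n" for j
          using that by (intro halts_by_mono[OF t] member_le_sum) auto
        then show ?thesis
          unfolding conv_lim_def conv_set_def by auto
      qed
      obtain m where m: "\<And>n. m \<le> n \<Longrightarrow> X \<in> conv_set e n (modulus e n)"
        using elim(2)[rule_format, of e] lim unfolding eventually_sequentially by blast
      \<comment> \<open>The finitely many confirmed items that could exclude \<open>X\<close>. Since
        \<open>X\<close> converges by the modulus from \<open>m\<close> on, each of them carries a
        wrong guess, which is current only for finitely many stages.\<close>
      define W where "W = {w \<in> J. X \<in> K w \<and> (\<exists>n t. w = item e n t \<and> m \<le> n)}"
      have "finite W"
        unfolding W_def by (rule finite_subset[OF _ elim(3)[rule_format, of e]]) auto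
      have "\<exists>s\<^sub>0. \<forall>s\<ge>s\<^sub>0. \<forall>n t. w = item e n t \<longrightarrow> \<not> current e (Suc n) s t" if "w \<in> W" for w
      proof -
        from that obtain n t where w: "w = item e n t" "m \<le> n" "X \<in> drop_set e n t"
          unfolding W_def using K_item by auto
        have "t \<noteq> modulus e (Suc n)"
          using w m[of "Suc n"] unfolding drop_set_def by auto
        with current_eventually[of e "Suc n"] show ?thesis
          unfolding w by (metis item_eq_iff)
      qed
      then obtain s\<^sub>1 where s\<^sub>1: "\<And>w s n t. w \<in> W \<Longrightarrow> s\<^sub>1 w \<le> s \<Longrightarrow> w = item e n t \<Longrightarrow> \<not> current e (Suc n) s t"
        by metis
      obtain s\<^sub>0 where s\<^sub>0: "\<And>s t. s\<^sub>0 \<le> s \<Longrightarrow> current e m s t \<longleftrightarrow> t = modulus e m"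
        using current_eventually by blast
      \<comment> \<open>From stage \<open>j\<close> on, the guess at \<open>m\<close> is correct and
        all guesses in \<open>W\<close> have been withdrawn, so \<open>X\<close> is never excluded
        from the class with these parameters.\<close>
      define j where "j = s\<^sub>0 + (\<Sum>w\<in>W. s\<^sub>1 w)"
      have no_exc: "\<not> exc e j m s X" for s
      proof
        assume "exc e j m s X"
        then obtain s' where s': "j \<le> s'" and
          "(\<exists>t. current e m s' t \<and> X \<notin> conv_set e m t) \<or>
           (\<exists>n t. m \<le> n \<and> S (item e n t) s' \<and> current e (Suc n) s' t \<and> X \<in> drop_set e n t)"
          unfolding exc_def by blast
        then consider t where "current e m s' t" "X \<notin> conv_set e m t"
          | n t where "m \<le> n" "S (item e n t) s'" "current e (Suc n) s' t" "X \<in> drop_set e n t"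
          by blast
        then show False
        proof cases
          case 1
          with s\<^sub>0[of s' t] s' m[of m] show False
            by (auto simp: j_def)
        next
          case (2 n t)
          then have W: "item e n t \<in> W"
            unfolding W_def using S(2) K_item by auto
          have "s\<^sub>1 (item e n t) \<le> (\<Sum>w\<in>W. s\<^sub>1 w)"
            using \<open>finite W\<close> W by (intro member_le_sum) auto
          with s' have "s\<^sub>1 (item e n t) \<le> s'"
            by (simp add: j_def)
          with s\<^sub>1[OF W] 2(3) show False
            by blast
        qed
      qed
      define i where "i = prod_encode (e, prod_encode (j, m))"
      obtain N where N: "\<And>n. N \<le> n \<Longrightarrow> \<not> bad i (Suc n) (f n) X"
        using elim(1)[rule_format, of i] by (auto simp: eventually_sequentially)
      \<comment> \<open>Not bad and not excluded means converged by stage \<open>f n\<close>, and a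
        halting stage exceeds the output.\<close>
      have "g n \<le> f n" if "N \<le> n" for n
      proof -
        have "X \<in> conv_set e (Suc n) (f n)"
          using N[OF that] no_exc unfolding bad_def i_def by simp
        then have "halts_by X (index p) n (f n)"
          unfolding conv_set_def e_def by simp
        then obtain r where "r < f n" "eval X p n r"
          using halts_by_eval by blast
        with eval_det[OF p[of n]] show ?thesis
          by force
      qed
      then show "dominates f g"
        unfolding dominates_def by (intro exI[of _ N]) auto
    qed
  qed
  with f show ?thesis
    unfolding uniformly_ae_dominating_def by blast
qed

lemma uniformly_ae_dominating_imp_ae_dominating:
  "uniformly_ae_dominating B \<Longrightarrow> ae_dominating B"
  unfolding uniformly_ae_dominating_def ae_dominating_def by (auto elim: AE_mp)

theorem corollary3p3:
  fixes B :: cantor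
  shows "(uniformly_ae_dominating B \<longleftrightarrow> ae_dominating B) \<and>
         (ae_dominating B \<longleftrightarrow> positive_measure_dominating B) \<and>
         (positive_measure_dominating B \<longleftrightarrow> halting_set \<le>\<^sub>L\<^sub>R B)"
  using uniformly_ae_dominating_imp_ae_dominating ae_dominating_imp_positive_measure_dominating
    positive_measure_dominating_imp_covers_sigma2 covers_sigma2_imp_LR_reducible
    LR_reducible_imp_covers_sigma2 covers_sigma2_imp_uniformly_ae_dominating
  by blast

end
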